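(* Let $n\ge2$ and let $\Omega=\Omega_0\setminus\overline{\Omega_1}\subset\mathbb R^n$, where $\Omega_0$ and $\Omega_1$ are bounded smooth strictly convex domains and $\overline{\Omega_1}\Subset\Omega_0$. Let $\mathcal U\subset\mathbb R^n$ be open, let $a\in C^0(\mathcal U,\operatorname{Sym}_n)$ satisfy $a(q)>0$ for every $q\in\mathcal U$, and let $u\in C^3(\Omega)\cap C^2(\overline\Omega)$ satisfy $Du(\overline\Omega)\subset\mathcal U$ and solve $$\begin{cases}\sum_{i,j=1}^n a^{ij}(Du)\,u_{ij}=0&\text{in }\Omega,\\ u=0&\text{on }\partial\Omega_0,\\ u=1&\text{on }\partial\Omega_1.\end{cases}$$ Assume that $|Du|>0$ in $\overline\Omega$, and that every superlevel body $$K_t=\overline{\Omega_1}\cup\{x\in\overline\Omega:u(x)\ge t\},\qquad 0\le t\le1,$$ has smooth strictly convex boundary. Then $$(-1)^{n-1}\det D^2u>0\qquad\text{in }\Omega .$$ Moreover, $Du$ is a global $C^2$-diffeomorphism from $\Omega$ onto a radially parametrized ring in gradient space.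
   Context: $\operatorname{Sym}_n$ is the space of real symmetric $n\times n$ matrices; $a>0$ means positive definite; $a^{ij}$ are the entries of $a$, $Du$ is the gradient, $u_{ij}=\partial_i\partial_ju$, $D^2u$ the Hessian. A smooth convex hypersurface is called strictly convex if its second fundamental form is positive definite (sign convention: spheres have positive principal curvatures with respect to the outward unit normal); a bounded smooth strictly convex domain is a bounded convex domain with smooth strictly convex boundary. "Radially parametrized ring in gradient space" means the set $$\{r\nu:\nu\in\mathbb S^{n-1},\ \rho_0(\nu)<r<\rho_1(\nu)\},$$ where, for $i=0,1$ and $\nu\in\mathbb S^{n-1}$, $x_i(\nu)\in\partial\Omega_i$ is the point at which $Du/|Du|=\nu$ and $\rho_i(\nu)=|Du(x_i(\nu))|$, with $0<\rho_0(\nu)<\rho_1(\nu)$ for every $\nu$. *)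

theory Defs
  imports "HOL-Analysis.Analysis"
begin

section \<open>Differentiability classes\<close>

text \<open>All derivatives are two-sided (\<open>at x\<close>, not \<open>at x within S\<close>), so \<open>Ck_on\<close> is the usual class
  \<open>C\<^sup>k(S)\<close> for open \<open>S\<close>; it is only used for open sets.\<close>

primrec Ck_on :: "nat \<Rightarrow> ('a::euclidean_space \<Rightarrow> 'b::real_normed_vector) \<Rightarrow> 'a set \<Rightarrow> bool" where
  "Ck_on 0 f S \<longleftrightarrow> continuous_on S f"
| "Ck_on (Suc k) f S \<longleftrightarrow>
     (\<forall>x\<in>S. f differentiable (at x)) \<and>
     (\<forall>b\<in>Basis. Ck_on k (\<lambda>x. frechet_derivative f (at x) b) S)"

definition smooth_on :: "('a::euclidean_space \<Rightarrow> 'b::real_normed_vector) \<Rightarrow> 'a set \<Rightarrow> bool" where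
  "smooth_on f S \<longleftrightarrow> (\<forall>k. Ck_on k f S)"

primrec partials_extend ::
  "nat \<Rightarrow> ('a::euclidean_space \<Rightarrow> 'b::real_normed_vector) \<Rightarrow> 'a set \<Rightarrow> bool" where
  "partials_extend 0 f S \<longleftrightarrow> (\<exists>g. continuous_on (closure S) g \<and> (\<forall>x\<in>S. g x = f x))"
| "partials_extend (Suc k) f S \<longleftrightarrow>
     (\<exists>g. continuous_on (closure S) g \<and> (\<forall>x\<in>S. g x = f x)) \<and>
     (\<forall>b\<in>Basis. partials_extend k (\<lambda>x. frechet_derivative f (at x) b) S)"

text \<open>The class \<open>C\<^sup>k\<close> of the closure of an open set \<open>S\<close>: all partial derivatives of order at most
  \<open>k\<close> extend continuously from \<open>S\<close> to its closure. The function itself is given on the closure, so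
  there its own values are required to be the extension.\<close>

definition Ck_on_closure ::
  "nat \<Rightarrow> ('a::euclidean_space \<Rightarrow> 'b::real_normed_vector) \<Rightarrow> 'a set \<Rightarrow> bool" where
  "Ck_on_closure k f S \<longleftrightarrow>
     Ck_on k f S \<and> continuous_on (closure S) f \<and> partials_extend k f S"

definition Ck_diffeomorphism ::
  "nat \<Rightarrow> ('a::euclidean_space \<Rightarrow> 'b::euclidean_space) \<Rightarrow> 'a set \<Rightarrow> 'b set \<Rightarrow> bool" where
  "Ck_diffeomorphism k f S T \<longleftrightarrow>
     open S \<and> open T \<and> Ck_on k f S \<and> (\<exists>g. homeomorphism S T f g \<and> Ck_on k g T)"

section \<open>Gradient and Hessian\<close>

definition partial :: "'n::finite \<Rightarrow> (real^'n \<Rightarrow> real) \<Rightarrow> real^'n \<Rightarrow> real" where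
  "partial i u x = frechet_derivative u (at x) (axis i 1)"

definition gradient :: "(real^'n::finite \<Rightarrow> real) \<Rightarrow> real^'n \<Rightarrow> real^'n" where
  "gradient u x = (\<chi> i. partial i u x)"

definition hessian :: "(real^'n::finite \<Rightarrow> real) \<Rightarrow> real^'n \<Rightarrow> real^'n^'n" where
  "hessian u x = (\<chi> i j. partial i (partial j u) x)"

text \<open>\<open>Du\<close> on the closure of \<open>\<Omega>\<close>: the two-sided derivative is not available at boundary points,
  where \<open>Du\<close> is the continuous extension of the interior gradient.\<close>

definition gradient_closure ::
  "(real^'n::finite) set \<Rightarrow> (real^'n \<Rightarrow> real) \<Rightarrow> real^'n \<Rightarrow> real^'n" where
  "gradient_closure \<Omega> u x =
     (if x \<in> \<Omega> then gradient u x else Lim (at x within \<Omega>) (gradient u))"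

definition positive_definite :: "real^'n^'n::finite \<Rightarrow> bool" where
  "positive_definite A \<longleftrightarrow> (\<forall>v. v \<noteq> 0 \<longrightarrow> v \<bullet> (A *v v) > 0)"

section \<open>Smooth strictly convex boundaries\<close>

text \<open>For a regular hypersurface \<open>{\<phi> = 0}\<close> with unit normal field \<open>N = \<nabla>\<phi> / |\<nabla>\<phi>|\<close>, this is the
  second fundamental form \<open>II(v, w) = \<langle>D\<^sub>v N, w\<rangle>\<close>, to be used for tangent vectors \<open>v\<close>, \<open>w\<close>. If
  \<open>\<phi> < 0\<close> inside, \<open>N\<close> is the outward normal, and spheres have positive principal curvatures.\<close>

definition second_fundamental_form ::
  "(real^'n::finite \<Rightarrow> real) \<Rightarrow> real^'n \<Rightarrow> real^'n \<Rightarrow> real^'n \<Rightarrow> real" where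
  "second_fundamental_form \<phi> p v w =
     frechet_derivative (\<lambda>y. sgn (gradient \<phi> y)) (at p) v \<bullet> w"

text \<open>The boundary is smooth if near each of its points it is the regular zero set of a smooth
  function that is negative exactly on the interior. Strict convexity is a notion for convex
  hypersurfaces, i.e. for boundaries of convex sets with nonempty interior; this is why convexity of
  \<open>K\<close> is part of the definition.\<close>

definition smooth_strictly_convex_boundary :: "(real^'n::finite) set \<Rightarrow> bool" where
  "smooth_strictly_convex_boundary K \<longleftrightarrow>
     convex K \<and> interior K \<noteq> {} \<and>
     (\<forall>p\<in>frontier K. \<exists>U \<phi>.
        open U \<and> p \<in> U \<and> smooth_on \<phi> U \<and>
        (\<forall>x\<in>U. gradient \<phi> x \<noteq> 0) \<and>
        (\<forall>x\<in>U. x \<in> frontier K \<longleftrightarrow> \<phi> x = 0) \<and>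
        (\<forall>x\<in>U. x \<in> interior K \<longleftrightarrow> \<phi> x < 0) \<and>
        (\<forall>v. v \<noteq> 0 \<and> v \<bullet> gradient \<phi> p = 0 \<longrightarrow> second_fundamental_form \<phi> p v v > 0))"

definition smooth_strictly_convex_domain :: "(real^'n::finite) set \<Rightarrow> bool" where
  "smooth_strictly_convex_domain \<Omega> \<longleftrightarrow>
     open \<Omega> \<and> \<Omega> \<noteq> {} \<and> bounded \<Omega> \<and> convex \<Omega> \<and> smooth_strictly_convex_boundary \<Omega>"

definition superlevel_body ::
  "(real^'n::finite) set \<Rightarrow> (real^'n) set \<Rightarrow> (real^'n \<Rightarrow> real) \<Rightarrow> real \<Rightarrow> (real^'n) set" where
  "superlevel_body \<Omega> \<Omega>1 u t = closure \<Omega>1 \<union> {x \<in> closure \<Omega>. u x \<ge> t}"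

section \<open>Rings in gradient space\<close>

definition radial_ring ::
  "(real^'n::finite \<Rightarrow> real) \<Rightarrow> (real^'n \<Rightarrow> real) \<Rightarrow> (real^'n) set" where
  "radial_ring \<rho>0 \<rho>1 = {r *\<^sub>R \<nu> | r \<nu>. norm \<nu> = 1 \<and> \<rho>0 \<nu> < r \<and> r < \<rho>1 \<nu>}"

text \<open>\<open>x0\<close> and \<open>x1\<close> pick the unique points of the outer and inner boundary at which
  \<open>Du / |Du| = \<nu>\<close>; the radii of the ring are the values of \<open>|Du|\<close> there.\<close>

definition radially_parametrized_ring ::
  "(real^'n::finite) set \<Rightarrow> (real^'n) set \<Rightarrow> (real^'n \<Rightarrow> real^'n) \<Rightarrow> (real^'n) set \<Rightarrow> bool" where
  "radially_parametrized_ring \<Omega>0 \<Omega>1 Du R \<longleftrightarrow>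
     (\<exists>x0 x1.
        (\<forall>\<nu>. norm \<nu> = 1 \<longrightarrow>
           (\<forall>x. x \<in> frontier \<Omega>0 \<and> sgn (Du x) = \<nu> \<longleftrightarrow> x = x0 \<nu>) \<and>
           (\<forall>x. x \<in> frontier \<Omega>1 \<and> sgn (Du x) = \<nu> \<longleftrightarrow> x = x1 \<nu>) \<and>
           0 < norm (Du (x0 \<nu>)) \<and> norm (Du (x0 \<nu>)) < norm (Du (x1 \<nu>))) \<and>
        R = radial_ring (\<lambda>\<nu>. norm (Du (x0 \<nu>))) (\<lambda>\<nu>. norm (Du (x1 \<nu>))))"

end

theory Submission
  imports Defs
begin

text \<open>
  Everything happens on the level sets of \<open>u\<close>. Since \<open>Du\<close> has no zero, \<open>u\<close> has no interior extremum,
  so \<open>0 < u < 1\<close> in \<open>\<Omega>\<close>, and the set \<open>{u = t}\<close> is exactly the boundary of the body \<open>K\<^sub>t\<close>.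

  The sign of the determinant is linear algebra. Strict convexity of \<open>\<partial>K\<^sub>t\<close> says that the
  Hessian \<open>A\<close> of \<open>u\<close> is negative definite on the hyperplane orthogonal to \<open>Du\<close>
  (\<open>hessian_negative_on_level_set\<close>). The equation says that the trace of \<open>a A\<close> vanishes
  for a positive definite \<open>a\<close>, so \<open>A\<close>, which is not zero because \<open>n \<ge> 2\<close>, must be positive in some
  direction (\<open>positive_direction_of_trace_zero\<close>). Hence \<open>A\<close> has signature \<open>(1, n - 1)\<close>: it is called
  \<open>lorentzian\<close> below, and its determinant has the sign \<open>(-1)\<^bsup>n-1\<^esup>\<close> (\<open>lorentzian_det_sign\<close>).

  For the global statement, the Gauss map of each \<open>\<partial>K\<^sub>t\<close> is bijective (\<open>gauss_map_bijective\<close>), so the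
  points of \<open>closure \<Omega>\<close> are parametrized by a direction \<open>\<nu> = Du / |Du|\<close> and a level
  \<open>t \<in> [0, 1]\<close>; by compactness the parametrization is continuous. Fix \<open>\<nu>\<close> and follow the point
  \<open>x(t)\<close> as \<open>t\<close> grows. Differentiating \<open>Du(x(t)) = \<rho>(t) \<nu>\<close> and \<open>u(x(t)) = t\<close> gives
  \<open>1 = \<rho> \<rho>' (\<nu> \<bullet> A\<inverse> \<nu>)\<close>, and \<open>\<nu> \<bullet> A\<inverse> \<nu> > 0\<close> holds because \<open>A\<close> is Lorentzian
  (\<open>lorentzian_preimage_of_normal\<close>). So \<open>|Du|\<close> increases strictly along the curve
  (\<open>gradient_length_strictly_increasing\<close>). This makes \<open>Du\<close> injective on \<open>\<Omega>\<close>, and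
  with the intermediate value theorem its image is the ring between the values of \<open>|Du|\<close> on the two
  boundary components. The inverse is continuous by invariance of domain, and of class
  \<open>C\<^sup>2\<close> because the Hessian is invertible (\<open>Ck_on_inverse_map\<close>).
\<close>

section \<open>Calculus of the classes \<open>C\<^sup>k\<close>\<close>

lemma differentiable_transform_open:
  assumes "open S" "x \<in> S" "\<And>y. y \<in> S \<Longrightarrow> f y = g y" "f differentiable (at x)"
  shows "g differentiable (at x)"
proof -
  obtain f' where "(f has_derivative f') (at x)"
    using assms(4) by (auto simp: differentiable_def)
  then have "(g has_derivative f') (at x)"
    by (rule has_derivative_transform_within_open) (use assms in auto)
  then show ?thesis by (auto simp: differentiable_def)
qed

lemma Ck_on_cong:
  assumes "open S" and "\<And>x. x \<in> S \<Longrightarrow> f x = g x"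
  shows "Ck_on k f S \<longleftrightarrow> Ck_on k g S"
  using assms(2)
proof (induction k arbitrary: f g)
  case 0
  then show ?case using continuous_on_cong[of S S f g] by simp
next
  case (Suc k)
  have d: "f differentiable (at x) \<longleftrightarrow> g differentiable (at x)" if "x \<in> S" for x
    using differentiable_transform_open[OF \<open>open S\<close> that] Suc.prems by metis
  have e: "frechet_derivative f (at x) = frechet_derivative g (at x)"
    if "x \<in> S" "f differentiable (at x)" for x
    using frechet_derivative_transform_within_open[OF that(2) \<open>open S\<close> that(1)] Suc.prems by blast
  show ?case
  proof (cases "\<forall>x\<in>S. f differentiable (at x)")
    case True
    have "Ck_on k (\<lambda>x. frechet_derivative f (at x) b) S \<longleftrightarrow>
        Ck_on k (\<lambda>x. frechet_derivative g (at x) b) S" for b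
      by (rule Suc.IH) (use True e in simp)
    then show ?thesis using d by auto
  next
    case False
    then show ?thesis using d by auto
  qed
qed

lemma Ck_on_SucI:
  assumes "open S" and "\<And>x. x \<in> S \<Longrightarrow> (f has_derivative f' x) (at x)"
    and "\<And>b. b \<in> Basis \<Longrightarrow> Ck_on k (\<lambda>x. f' x b) S"
  shows "Ck_on (Suc k) f S"
proof -
  have "Ck_on k (\<lambda>x. frechet_derivative f (at x) b) S" if "b \<in> Basis" for b
  proof -
    have "frechet_derivative f (at x) b = f' x b" if "x \<in> S" for x
      using frechet_derivative_at[OF assms(2)[OF that]] by simp
    then show ?thesis
      using iffD2[OF Ck_on_cong[OF \<open>open S\<close>] assms(3)[OF \<open>b \<in> Basis\<close>]] by simp
  qed
  moreover have "f differentiable (at x)" if "x \<in> S" for x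
    using assms(2)[OF that] unfolding differentiable_def by blast
  ultimately show ?thesis unfolding Ck_on.simps(2)[of k f S] by blast
qed

lemma Ck_on_Suc_has_derivative:
  assumes "Ck_on (Suc k) f S" "x \<in> S"
  shows "(f has_derivative frechet_derivative f (at x)) (at x)"
  using assms by (intro iffD1[OF frechet_derivative_works]) simp

lemma Ck_on_derivative:
  assumes "Ck_on (Suc k) f S" "b \<in> Basis"
  shows "Ck_on k (\<lambda>x. frechet_derivative f (at x) b) S"
  using assms unfolding Ck_on.simps(2)[of k f S] by blast

lemma Ck_on_SucD: "Ck_on (Suc k) f S \<Longrightarrow> Ck_on k f S"
proof (induction k arbitrary: f)
  case 0
  then have "f differentiable_on S"
    by (intro differentiable_at_imp_differentiable_on) simp
  then show ?case by (simp add: differentiable_imp_continuous_on)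
next
  case (Suc k)
  have d: "\<forall>x\<in>S. f differentiable (at x)"
    and "\<forall>b\<in>Basis. Ck_on (Suc k) (\<lambda>x. frechet_derivative f (at x) b) S"
    using Suc.prems unfolding Ck_on.simps(2)[of "Suc k" f S] by blast+
  from this(2) have "\<forall>b\<in>Basis. Ck_on k (\<lambda>x. frechet_derivative f (at x) b) S"
    using Suc.IH by blast
  with d show ?case unfolding Ck_on.simps(2)[of k f S] by blast
qed

lemma Ck_on_le: "Ck_on k f S \<Longrightarrow> j \<le> k \<Longrightarrow> Ck_on j f S"
  by (induction k) (metis le_zero_eq, metis Ck_on_SucD le_Suc_eq)

lemma Ck_on_const: "open S \<Longrightarrow> Ck_on k (\<lambda>x. c) S"
proof (induction k arbitrary: c)
  case (Suc k)
  show ?case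
    by (rule Ck_on_SucI[where f' = "\<lambda>x h. 0"]) (rule Suc.prems has_derivative_const Suc.IH)+
qed simp

lemma Ck_on_bounded_linear:
  fixes f :: "'a::euclidean_space \<Rightarrow> 'b::real_normed_vector"
  assumes "bounded_linear L" "open S" "Ck_on k f S"
  shows "Ck_on k (\<lambda>x. L (f x)) S"
  using assms(3)
proof (induction k arbitrary: f)
  case 0
  then show ?case
    using bounded_linear.continuous_on[OF assms(1), of S f] by simp
next
  case (Suc k)
  show ?case
  proof (rule Ck_on_SucI[OF assms(2)])
    show "((\<lambda>x. L (f x)) has_derivative (\<lambda>h. L (frechet_derivative f (at x) h))) (at x)"
      if "x \<in> S" for x
      using bounded_linear.has_derivative[OF assms(1) Ck_on_Suc_has_derivative[OF Suc.prems that]] .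
    show "Ck_on k (\<lambda>x. L (frechet_derivative f (at x) b)) S" if "b \<in> Basis" for b
      by (rule Suc.IH) (use Suc.prems that in simp)
  qed
qed

lemma Ck_on_add:
  assumes "open S" "Ck_on k f S" "Ck_on k g S"
  shows "Ck_on k (\<lambda>x. f x + g x) S"
  using assms(2,3)
proof (induction k arbitrary: f g)
  case 0
  then show ?case by (auto intro: continuous_intros)
next
  case (Suc k)
  show ?case
  proof (rule Ck_on_SucI[OF assms(1)])
    show "((\<lambda>x. f x + g x) has_derivative
        (\<lambda>h. frechet_derivative f (at x) h + frechet_derivative g (at x) h)) (at x)" if "x \<in> S" for x
      using Suc.prems that by (intro has_derivative_add Ck_on_Suc_has_derivative)
    show "Ck_on k (\<lambda>x. frechet_derivative f (at x) b + frechet_derivative g (at x) b) S"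
      if "b \<in> Basis" for b
      by (rule Suc.IH) (use Suc.prems that in simp_all)
  qed
qed

lemma Ck_on_sum:
  assumes "open S" "\<And>i. i \<in> I \<Longrightarrow> Ck_on k (f i) S"
  shows "Ck_on k (\<lambda>x. \<Sum>i\<in>I. f i x) S"
  using assms(2)
proof (induction I rule: infinite_finite_induct)
  case (insert i I)
  then show ?case using Ck_on_add[OF assms(1), of k "f i"] by simp
qed (simp_all add: Ck_on_const[OF assms(1)])

lemma Ck_on_scaleR:
  fixes f :: "'a::euclidean_space \<Rightarrow> real"
  assumes "open S" "Ck_on k f S" "Ck_on k g S"
  shows "Ck_on k (\<lambda>x. f x *\<^sub>R g x) S"
  using assms(2,3)
proof (induction k arbitrary: f g)
  case 0
  then show ?case by (auto intro: continuous_intros)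
next
  case (Suc k)
  show ?case
  proof (rule Ck_on_SucI[OF assms(1)])
    show "((\<lambda>x. f x *\<^sub>R g x) has_derivative
        (\<lambda>h. f x *\<^sub>R frechet_derivative g (at x) h + frechet_derivative f (at x) h *\<^sub>R g x)) (at x)"
      if "x \<in> S" for x
      using Suc.prems that by (intro has_derivative_scaleR Ck_on_Suc_has_derivative)
    show "Ck_on k (\<lambda>x. f x *\<^sub>R frechet_derivative g (at x) b
        + frechet_derivative f (at x) b *\<^sub>R g x) S" if "b \<in> Basis" for b
      using Suc.prems that Ck_on_SucD[OF Suc.prems(1)] Ck_on_SucD[OF Suc.prems(2)]
      by (intro Ck_on_add[OF assms(1)] Suc.IH) auto
  qed
qed

lemma Ck_on_mult:
  fixes f g :: "'a::euclidean_space \<Rightarrow> real"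
  assumes "open S" "Ck_on k f S" "Ck_on k g S"
  shows "Ck_on k (\<lambda>x. f x * g x) S"
  using Ck_on_scaleR[OF assms] by simp

lemma Ck_on_prod:
  fixes f :: "'i \<Rightarrow> 'a::euclidean_space \<Rightarrow> real"
  assumes "open S" "\<And>i. i \<in> I \<Longrightarrow> Ck_on k (f i) S"
  shows "Ck_on k (\<lambda>x. \<Prod>i\<in>I. f i x) S"
  using assms(2)
proof (induction I rule: infinite_finite_induct)
  case (insert i I)
  then show ?case using Ck_on_mult[OF assms(1), of k "f i"] by simp
qed (simp_all add: Ck_on_const[OF assms(1)])

lemma Ck_on_inverse:
  fixes f :: "'a::euclidean_space \<Rightarrow> real"
  assumes "open S" "Ck_on k f S" "\<And>x. x \<in> S \<Longrightarrow> f x \<noteq> 0"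
  shows "Ck_on k (\<lambda>x. inverse (f x)) S"
  using assms(2)
proof (induction k)
  case 0
  then show ?case using assms(3) by (simp add: continuous_on_inverse)
next
  case (Suc k)
  have IH: "Ck_on k (\<lambda>x. inverse (f x)) S"
    by (rule Suc.IH[OF Ck_on_SucD[OF Suc.prems]])
  show ?case
  proof (rule Ck_on_SucI[OF assms(1)])
    show "((\<lambda>x. inverse (f x)) has_derivative
        (\<lambda>h. - (inverse (f x) * frechet_derivative f (at x) h * inverse (f x)))) (at x)"
      if "x \<in> S" for x
      by (rule Deriv.has_derivative_inverse[OF assms(3)[OF that] Ck_on_Suc_has_derivative[OF Suc.prems that]])
    show "Ck_on k (\<lambda>x. - (inverse (f x) * frechet_derivative f (at x) b * inverse (f x))) S"
      if b: "b \<in> Basis" for b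
    proof -
      have "Ck_on k (\<lambda>x. frechet_derivative f (at x) b) S"
        using Suc.prems b unfolding Ck_on.simps(2)[of k f S] by blast
      then show ?thesis
        by (intro Ck_on_bounded_linear[OF bounded_linear_minus[OF bounded_linear_ident] assms(1)]
            Ck_on_mult[OF assms(1)] IH)
    qed
  qed
qed

lemma Ck_on_componentwise:
  fixes f :: "'a::euclidean_space \<Rightarrow> real^'m::finite"
  assumes "open S" "\<And>i. Ck_on k (\<lambda>x. f x $ i) S"
  shows "Ck_on k f S"
proof -
  have "Ck_on k (\<lambda>x. \<Sum>i\<in>UNIV. (f x $ i) *\<^sub>R (axis i 1 :: real^'m)) S"
    by (intro Ck_on_sum Ck_on_scaleR Ck_on_const assms)
  moreover have "(\<Sum>i\<in>UNIV. (f x $ i) *\<^sub>R axis i 1) = f x" for x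
    using basis_expansion[of "f x"] unfolding scalar_mult_eq_scaleR .
  ultimately show ?thesis by (simp only:)
qed

lemma Ck_on_compose:
  fixes f :: "'b::euclidean_space \<Rightarrow> 'c::real_normed_vector"
    and g :: "'a::euclidean_space \<Rightarrow> 'b"
  assumes "open S" "open T" "g ` S \<subseteq> T" "Ck_on k f T" "Ck_on k g S"
  shows "Ck_on k (\<lambda>x. f (g x)) S"
  using assms(4,5)
proof (induction k arbitrary: f)
  case 0
  then show ?case using assms(3) continuous_on_compose2[of T f S g] by simp
next
  case (Suc k)
  let ?f' = "\<lambda>y. frechet_derivative f (at y)" and ?g' = "\<lambda>x. frechet_derivative g (at x)"
  show ?case
  proof (rule Ck_on_SucI[OF assms(1)])
    fix x assume x: "x \<in> S"
    have gx: "g x \<in> T" using x assms(3) by blast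
    have f: "(f has_derivative ?f' (g x)) (at (g x))"
      by (rule Ck_on_Suc_has_derivative[OF Suc.prems(1) gx])
    have "((\<lambda>x. f (g x)) has_derivative (\<lambda>h. ?f' (g x) (?g' x h))) (at x)"
      by (rule has_derivative_compose[OF Ck_on_Suc_has_derivative[OF Suc.prems(2) x] f])
    moreover have "?f' (g x) v = (\<Sum>i\<in>Basis. (v \<bullet> i) *\<^sub>R ?f' (g x) i)" for v
    proof -
      have "linear (?f' (g x))" using f has_derivative_linear by blast
      then have "?f' (g x) (\<Sum>i\<in>Basis. (v \<bullet> i) *\<^sub>R i) = (\<Sum>i\<in>Basis. (v \<bullet> i) *\<^sub>R ?f' (g x) i)"
        by (simp add: linear_sum linear_cmul)
      then show ?thesis by (simp add: euclidean_representation)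
    qed
    then have "(\<lambda>h. ?f' (g x) (?g' x h)) = (\<lambda>h. \<Sum>i\<in>Basis. (?g' x h \<bullet> i) *\<^sub>R ?f' (g x) i)"
      by (rule ext)
    ultimately show "((\<lambda>x. f (g x)) has_derivative
        (\<lambda>h. \<Sum>i\<in>Basis. (?g' x h \<bullet> i) *\<^sub>R ?f' (g x) i)) (at x)"
      by (simp only:)
  next
    fix b :: 'a assume b: "b \<in> Basis"
    show "Ck_on k (\<lambda>x. \<Sum>i\<in>Basis. (?g' x b \<bullet> i) *\<^sub>R ?f' (g x) i) S"
    proof (intro Ck_on_sum[OF assms(1)] Ck_on_scaleR[OF assms(1)])
      fix i :: 'b assume i: "i \<in> Basis"
      from Ck_on_derivative[OF Suc.prems(2) b] show "Ck_on k (\<lambda>x. ?g' x b \<bullet> i) S"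
        by (rule Ck_on_bounded_linear[OF bounded_linear_inner_left assms(1)])
      from Ck_on_derivative[OF Suc.prems(1) i] show "Ck_on k (\<lambda>x. ?f' (g x) i) S"
        by (rule Suc.IH[OF _ Ck_on_SucD[OF Suc.prems(2)]])
    qed
  qed
qed

lemma Ck_on_det:
  fixes M :: "'a::euclidean_space \<Rightarrow> real^'n^'n::finite"
  assumes "open S" "\<And>i j. Ck_on k (\<lambda>x. M x $ i $ j) S"
  shows "Ck_on k (\<lambda>x. det (M x)) S"
  unfolding det_def
  by (intro Ck_on_sum Ck_on_mult Ck_on_prod Ck_on_const assms)

lemma matrix_derivative_mult:
  fixes f :: "real^'n::finite \<Rightarrow> real^'m::finite"
  assumes "(f has_derivative f') (at x)"
  shows "matrix f' *v h = f' h"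
  using has_derivative_linear[OF assms] by (simp add: matrix_works linear_matrix_vector_mul_eq)

text \<open>Cramer's rule writes the derivative of the inverse as a rational expression in the first
  derivatives of \<open>f\<close> at \<open>g y\<close>, so each degree of smoothness of \<open>g\<close> gives the next one.\<close>

lemma Ck_on_inverse_map:
  fixes f g :: "real^'n::finite \<Rightarrow> real^'n"
  assumes "open S" "open T" "homeomorphism S T f g" "Ck_on (Suc k) f S"
    and det: "\<And>x. x \<in> S \<Longrightarrow> det (matrix (frechet_derivative f (at x))) \<noteq> 0"
  shows "Ck_on (Suc k) g T"
proof -
  define J where "J x = matrix (frechet_derivative f (at x))" for x
  define D where "D y h = (\<chi> l. det (\<chi> i j. if j = l then h $ i else J (g y) $ i $ j)
      * inverse (det (J (g y))))" for y h
  have gS: "g y \<in> S" and fg: "f (g y) = y" if "y \<in> T" for y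
    using assms(3) that by (auto simp: homeomorphism_def)
  have cramer: "J (g y) *v D y h = h" if "y \<in> T" for y h
  proof -
    have "det (J (g y)) \<noteq> 0" using det[OF gS[OF that]] by (simp add: J_def)
    from cramer[OF this, of "D y h" h] show ?thesis
      by (simp only: D_def divide_inverse)
  qed
  have der: "(g has_derivative D y) (at y)" if y: "y \<in> T" for y
  proof -
    have f': "(f has_derivative frechet_derivative f (at (g y))) (at (g y))"
      using assms(4) gS[OF y] by (rule Ck_on_Suc_has_derivative)
    have "frechet_derivative f (at (g y)) \<circ> D y = id"
      using cramer[OF y] matrix_derivative_mult[OF f'] by (auto simp: J_def fun_eq_iff)
    from has_derivative_inverse_strong_x[of S g y f, OF assms(1) gS[OF y] _ _ f' this fg[OF y]]
    show ?thesis using assms(3) by (simp add: homeomorphism_def)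
  qed
  have J: "Ck_on k (\<lambda>x. J x $ i $ j) S" for i j
  proof -
    have "Ck_on k (\<lambda>x. frechet_derivative f (at x) (axis j 1)) S"
      by (rule Ck_on_derivative[OF assms(4)]) simp
    from Ck_on_bounded_linear[OF bounded_linear_vec_nth[of i] assms(1) this]
    show ?thesis by (simp add: J_def matrix_def)
  qed
  have "Ck_on m g T" if "m \<le> Suc k" for m
    using that
  proof (induction m)
    case 0
    then show ?case using assms(3) by (simp add: homeomorphism_def)
  next
    case (Suc m)
    have Jg: "Ck_on m (\<lambda>y. J (g y) $ i $ j) T" for i j
    proof (rule Ck_on_compose[OF assms(2,1), where f = "\<lambda>x. J x $ i $ j"])
      show "Ck_on m (\<lambda>x. J x $ i $ j) S"
        using Ck_on_le[OF J] Suc.prems by simp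
      show "Ck_on m g T" using Suc by simp
    qed (use gS in blast)
    show ?case
    proof (rule Ck_on_SucI[OF assms(2), where f' = D])
      fix b :: "real^'n"
      have "Ck_on m (\<lambda>y. D y b $ l) T" for l
      proof -
        have "Ck_on m (\<lambda>y. det (\<chi> i j. if j = l then b $ i else J (g y) $ i $ j)) T"
        proof (rule Ck_on_det[OF assms(2)])
          show "Ck_on m (\<lambda>y. (\<chi> i j. if j = l then b $ i else J (g y) $ i $ j) $ i $ j) T" for i j
            using Jg[of i j] Ck_on_const[OF assms(2), of m "b $ i"] by (cases "j = l") simp_all
        qed
        moreover have "Ck_on m (\<lambda>y. inverse (det (J (g y)))) T"
        proof (rule Ck_on_inverse[OF assms(2) Ck_on_det[OF assms(2) Jg]])
          show "det (J (g y)) \<noteq> 0" if "y \<in> T" for y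
            using det[OF gS[OF that]] by (simp add: J_def)
        qed
        ultimately show ?thesis
          unfolding D_def vec_lambda_beta by (rule Ck_on_mult[OF assms(2)])
      qed
      then show "Ck_on m (\<lambda>y. D y b) T" by (rule Ck_on_componentwise[OF assms(2)])
    qed (rule der)
  qed
  then show ?thesis by blast
qed

section \<open>Gradient and Hessian\<close>

lemma line_derivative:
  fixes f :: "'a::real_normed_vector \<Rightarrow> real"
  assumes "(f has_derivative f') (at (x + s *\<^sub>R v))"
  shows "((\<lambda>s. f (x + s *\<^sub>R v)) has_real_derivative f' v) (at s)"
proof -
  have "((\<lambda>s. x + s *\<^sub>R v) has_derivative (\<lambda>h. h *\<^sub>R v)) (at s)"
    by (auto intro!: derivative_eq_intros)
  from has_derivative_compose[OF this assms]
  have "((\<lambda>s. f (x + s *\<^sub>R v)) has_derivative (\<lambda>h. f' (h *\<^sub>R v))) (at s)" .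
  moreover have "f' (h *\<^sub>R v) = f' v * h" for h
    using linear_cmul[OF has_derivative_linear[OF assms]] by simp
  ultimately show ?thesis by (simp add: has_field_derivative_def)
qed

text \<open>Applying the mean value theorem first in the direction \<open>v\<close> and then in the direction \<open>w\<close> turns the
  mixed difference into a second derivative at a nearby point. The difference is symmetric in \<open>v\<close>
  and \<open>w\<close>, hence so are the second derivatives wherever they are continuous.\<close>

lemma mixed_difference:
  fixes f :: "'a::euclidean_space \<Rightarrow> real"
  assumes f: "\<And>y. y \<in> ball x r \<Longrightarrow> (f has_derivative f' y) (at y)"
    and f': "\<And>y. y \<in> ball x r \<Longrightarrow> ((\<lambda>y. f' y v) has_derivative f'' y) (at y)"
    and h: "0 < h" "2 * h < r" and vw: "norm v = 1" "norm w = 1"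
  shows "\<exists>y\<in>cball x (2 * h).
    f (x + h *\<^sub>R v + h *\<^sub>R w) - f (x + h *\<^sub>R v) - f (x + h *\<^sub>R w) + f x = h * h * f'' y w"
proof -
  have in_cball: "x + s *\<^sub>R v + t *\<^sub>R w \<in> cball x (2 * h)"
    if "0 \<le> s" "s \<le> h" "0 \<le> t" "t \<le> h" for s t
  proof -
    have "norm (s *\<^sub>R v + t *\<^sub>R w) \<le> norm (s *\<^sub>R v) + norm (t *\<^sub>R w)"
      by (rule norm_triangle_ineq)
    also have "\<dots> \<le> 2 * h" using that vw by simp
    finally have "norm ((x + s *\<^sub>R v + t *\<^sub>R w) - x) \<le> 2 * h" by (simp add: add.assoc)
    then show ?thesis by (simp only: mem_cball dist_norm norm_minus_commute)
  qed
  then have in_ball: "x + s *\<^sub>R v + t *\<^sub>R w \<in> ball x r"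
    if "0 \<le> s" "s \<le> h" "0 \<le> t" "t \<le> h" for s t
    using in_cball[OF that] h(2) by simp
  define p where "p s = f ((x + h *\<^sub>R w) + s *\<^sub>R v) - f (x + s *\<^sub>R v)" for s
  have "\<exists>s>0. s < h \<and> p h - p 0 =
      (h - 0) * (f' ((x + h *\<^sub>R w) + s *\<^sub>R v) v - f' (x + s *\<^sub>R v) v)"
  proof (rule MVT2[OF h(1)])
    fix s assume s: "0 \<le> s" "s \<le> h"
    have a: "(x + h *\<^sub>R w) + s *\<^sub>R v \<in> ball x r" "x + s *\<^sub>R v \<in> ball x r"
      using in_ball[OF s, of h] in_ball[OF s, of 0] h(1) by (simp_all add: ac_simps)
    show "(p has_real_derivative f' ((x + h *\<^sub>R w) + s *\<^sub>R v) v - f' (x + s *\<^sub>R v) v) (at s)"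
      unfolding p_def by (rule DERIV_diff[OF line_derivative[OF f[OF a(1)]] line_derivative[OF f[OF a(2)]]])
  qed
  then obtain s where s: "0 < s" "s < h"
    and ps: "p h - p 0 = h * (f' ((x + s *\<^sub>R v) + h *\<^sub>R w) v - f' ((x + s *\<^sub>R v) + 0 *\<^sub>R w) v)"
    by (auto simp: ac_simps)
  have "\<exists>t>0. t < h \<and> f' ((x + s *\<^sub>R v) + h *\<^sub>R w) v - f' ((x + s *\<^sub>R v) + 0 *\<^sub>R w) v =
      (h - 0) * f'' ((x + s *\<^sub>R v) + t *\<^sub>R w) w"
  proof (rule MVT2[OF h(1)])
    fix t assume t: "0 \<le> t" "t \<le> h"
    have a: "(x + s *\<^sub>R v) + t *\<^sub>R w \<in> ball x r"
      using in_ball[OF _ _ t, of s] s by simp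
    show "((\<lambda>t. f' ((x + s *\<^sub>R v) + t *\<^sub>R w) v) has_real_derivative
        f'' ((x + s *\<^sub>R v) + t *\<^sub>R w) w) (at t)"
      by (rule line_derivative[OF f'[OF a]])
  qed
  then obtain t where t: "0 < t" "t < h"
    and "f' ((x + s *\<^sub>R v) + h *\<^sub>R w) v - f' ((x + s *\<^sub>R v) + 0 *\<^sub>R w) v =
      h * f'' ((x + s *\<^sub>R v) + t *\<^sub>R w) w" by auto
  with ps have "p h - p 0 = h * h * f'' ((x + s *\<^sub>R v) + t *\<^sub>R w) w" by simp
  moreover have "p h - p 0 =
      f (x + h *\<^sub>R v + h *\<^sub>R w) - f (x + h *\<^sub>R v) - f (x + h *\<^sub>R w) + f x"
    by (simp add: p_def ac_simps)
  ultimately show ?thesis using in_cball[of s t] s t by auto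
qed

lemma symmetric_second_derivative:
  fixes f :: "'a::euclidean_space \<Rightarrow> real"
  assumes S: "open S" "x \<in> S" and f: "Ck_on (Suc (Suc 0)) f S" and vw: "v \<in> Basis" "w \<in> Basis"
  shows "frechet_derivative (\<lambda>y. frechet_derivative f (at y) v) (at x) w =
    frechet_derivative (\<lambda>y. frechet_derivative f (at y) w) (at x) v"
proof -
  define f' where "f' y = frechet_derivative f (at y)" for y
  define P where "P a b y = frechet_derivative (\<lambda>y. f' y a) (at y) b" for a b y
  have f': "(f has_derivative f' y) (at y)" if "y \<in> S" for y
    unfolding f'_def by (rule Ck_on_Suc_has_derivative[OF f that])
  have C1: "Ck_on (Suc 0) (\<lambda>y. f' y a) S" if "a \<in> Basis" for a
    unfolding f'_def by (rule Ck_on_derivative[OF f that])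
  have f'': "((\<lambda>y. f' y a) has_derivative (\<lambda>b. P a b y)) (at y)" if "a \<in> Basis" "y \<in> S" for a y
    unfolding P_def by (rule Ck_on_Suc_has_derivative[OF C1[OF that(1)] that(2)])
  have cont: "isCont (P a b) x" if "a \<in> Basis" "b \<in> Basis" for a b
    using Ck_on_derivative[OF C1[OF that(1)] that(2)] S
    by (simp add: P_def[abs_def] continuous_on_eq_continuous_at)
  obtain r where r: "0 < r" "ball x r \<subseteq> S" using S open_contains_ball by blast
  have "P v w x = P w v x"
  proof (rule ccontr)
    assume "P v w x \<noteq> P w v x"
    define e where "e = \<bar>P v w x - P w v x\<bar> / 2"
    have e: "e > 0" using \<open>P v w x \<noteq> P w v x\<close> by (simp add: e_def)
    obtain d1 where d1: "d1 > 0" "\<And>y. dist y x < d1 \<Longrightarrow> dist (P v w y) (P v w x) < e"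
      using cont[OF vw] e unfolding continuous_at_eps_delta dist_norm by (metis real_norm_def)
    obtain d2 where d2: "d2 > 0" "\<And>y. dist y x < d2 \<Longrightarrow> dist (P w v y) (P w v x) < e"
      using cont[OF vw(2,1)] e unfolding continuous_at_eps_delta dist_norm by (metis real_norm_def)
    define h where "h = min (min d1 d2) r / 4"
    have h: "0 < h" "2 * h < r" "2 * h < d1" "2 * h < d2"
      using r d1(1) d2(1) by (auto simp: h_def min_def)
    let ?D = "f (x + h *\<^sub>R v + h *\<^sub>R w) - f (x + h *\<^sub>R v) - f (x + h *\<^sub>R w) + f x"
    have nb: "norm v = 1" "norm w = 1" using vw by simp_all
    obtain y where y: "y \<in> cball x (2 * h)" "?D = h * h * P v w y"
      using mixed_difference[of x r f f' v "\<lambda>y b. P v b y" h w] f' f''[OF vw(1)] r h(1,2) nb by blast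
    obtain z where z: "z \<in> cball x (2 * h)"
      "f (x + h *\<^sub>R w + h *\<^sub>R v) - f (x + h *\<^sub>R w) - f (x + h *\<^sub>R v) + f x = h * h * P w v z"
      using mixed_difference[of x r f f' w "\<lambda>y b. P w b y" h v] f' f''[OF vw(2)] r h(1,2) nb by blast
    have "?D = h * h * P w v z" using z(2) by (simp add: ac_simps)
    then have "P v w y = P w v z" using y(2) h(1) by simp
    moreover have "\<bar>P v w y - P v w x\<bar> < e" "\<bar>P w v z - P w v x\<bar> < e"
      using d1(2)[of y] d2(2)[of z] y(1) z(1) h by (auto simp: dist_commute dist_real_def)
    ultimately show False unfolding e_def by (smt (verit) field_sum_of_halves)
  qed
  then show ?thesis by (simp add: P_def f'_def)
qed


lemma axis_one_in_Basis: "axis i (1::real) \<in> Basis"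
  by simp

lemma hessian_symmetric:
  assumes "open S" "x \<in> S" "Ck_on (Suc (Suc 0)) u S"
  shows "hessian u x $ i $ j = hessian u x $ j $ i"
  using symmetric_second_derivative[OF assms axis_one_in_Basis[of i] axis_one_in_Basis[of j]]
  by (simp add: hessian_def partial_def[abs_def])

lemma gradient_has_derivative:
  assumes "(u has_derivative u') (at x)"
  shows "(u has_derivative (\<lambda>h. gradient u x \<bullet> h)) (at x)"
proof -
  have u': "frechet_derivative u (at x) = u'"
    using frechet_derivative_at[OF assms] by simp
  have "u' h = gradient u x \<bullet> h" for h
  proof -
    have "u' (\<Sum>i\<in>UNIV. (h $ i) *\<^sub>R axis i 1) = (\<Sum>i\<in>UNIV. (h $ i) *\<^sub>R u' (axis i 1))"
      using has_derivative_linear[OF assms] by (simp add: linear_sum linear_cmul)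
    moreover have "(\<Sum>i\<in>UNIV. (h $ i) *\<^sub>R axis i 1) = h"
      using basis_expansion[of h] unfolding scalar_mult_eq_scaleR .
    ultimately show ?thesis
      by (simp add: gradient_def partial_def u' inner_vec_def mult.commute)
  qed
  then have "u' = (\<lambda>h. gradient u x \<bullet> h)" by (rule ext)
  then show ?thesis using assms by simp
qed

lemma gradient_has_derivative_C1:
  assumes "Ck_on (Suc k) u S" "x \<in> S"
  shows "(u has_derivative (\<lambda>h. gradient u x \<bullet> h)) (at x)"
  by (rule gradient_has_derivative[OF Ck_on_Suc_has_derivative[OF assms]])

lemma Ck_on_partial: "Ck_on (Suc k) u S \<Longrightarrow> Ck_on k (partial i u) S"
  unfolding partial_def[abs_def] by (rule Ck_on_derivative) simp_all

lemma Ck_on_gradient: "open S \<Longrightarrow> Ck_on (Suc k) u S \<Longrightarrow> Ck_on k (gradient u) S"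
  by (rule Ck_on_componentwise) (simp_all add: gradient_def Ck_on_partial[unfolded partial_def] partial_def)

lemma hessian_has_derivative:
  assumes "open S" "x \<in> S" "Ck_on (Suc (Suc k)) u S"
  shows "(gradient u has_derivative (\<lambda>h. hessian u x *v h)) (at x)"
proof -
  have C2: "Ck_on (Suc (Suc 0)) u S" by (rule Ck_on_le[OF assms(3)]) simp
  have "((\<lambda>y. gradient u y $ i) has_derivative (\<lambda>h. (hessian u x *v h) $ i)) (at x)" for i
  proof -
    have "(partial i u has_derivative (\<lambda>h. gradient (partial i u) x \<bullet> h)) (at x)"
      by (rule gradient_has_derivative_C1[OF Ck_on_partial[OF assms(3)] assms(2)])
    moreover have "gradient (partial i u) x \<bullet> h = (hessian u x *v h) $ i" for h
    proof -
      have "gradient (partial i u) x $ j = hessian u x $ i $ j" for j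
        using hessian_symmetric[OF assms(1,2) C2, of i j] by (simp add: gradient_def hessian_def)
      then show ?thesis by (simp add: inner_vec_def matrix_vector_mult_def)
    qed
    ultimately show ?thesis by (simp add: gradient_def)
  qed
  then have "((\<lambda>y. gradient u y \<bullet> b) has_derivative (\<lambda>h. (hessian u x *v h) \<bullet> b)) (at x)"
    if "b \<in> Basis" for b
    using that by (auto simp: Basis_vec_def inner_axis)
  then show ?thesis by (subst has_derivative_componentwise_within) blast
qed

section \<open>Second order comparison along parabolas\<close>

lemma increasing_of_second_derivative:
  fixes g :: "real \<Rightarrow> real"
  assumes d: "0 < d" and g: "\<And>s. \<bar>s\<bar> < d \<Longrightarrow> (g has_real_derivative g' s) (at s)"
    and g0: "g' 0 = 0" and g'': "(g' has_real_derivative c) (at 0)" "0 < c"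
  shows "\<forall>\<^sub>F s in at_right 0. g 0 < g s"
proof -
  obtain e where e: "0 < e" "\<And>h. 0 < h \<Longrightarrow> h < e \<Longrightarrow> g' 0 < g' (0 + h)"
    using DERIV_pos_inc_right[OF g''] by blast
  have "g 0 < g s" if s: "0 < s" "s < min d e" for s
  proof (rule DERIV_pos_imp_increasing_open[OF s(1)])
    show "\<exists>y. (g has_real_derivative y) (at t) \<and> 0 < y" if "0 < t" "t < s" for t
    proof (intro exI conjI)
      show "(g has_real_derivative g' t) (at t)" using g that s by simp
      show "0 < g' t" using e(2)[of t] g0 that s by simp
    qed
    show "continuous_on {0..s} g"
    proof (rule DERIV_continuous_on)
      show "(g has_real_derivative g' t) (at t within {0..s})" if "t \<in> {0..s}" for t
        using g[of t] s that by (simp add: has_field_derivative_at_within)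
    qed
  qed
  then show ?thesis
    using d e(1) by (intro eventually_at_rightI[of 0 "min d e"]) simp_all
qed

lemma parabola_derivative:
  "((\<lambda>s. x + s *\<^sub>R v + (s * s) *\<^sub>R w) has_derivative (\<lambda>h. h *\<^sub>R (v + (2 * s) *\<^sub>R w))) (at s)"
  for x v w :: "'a::real_normed_vector"
  by (auto intro!: derivative_eq_intros simp: algebra_simps fun_eq_iff)

text \<open>The bending term \<open>s\<^sup>2 w\<close> contributes \<open>2 (Du \<bullet> w)\<close> to the second derivative at \<open>s = 0\<close>. Moving
  along such parabolas, rather than along tangent lines, compares the Hessians of two functions
  that have the same level set.\<close>

lemma growth_along_parabola:
  assumes S: "open S" "x \<in> S" and u: "Ck_on (Suc (Suc 0)) u S"
    and v: "gradient u x \<bullet> v = 0"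
    and pos: "0 < v \<bullet> (hessian u x *v v) + 2 * (gradient u x \<bullet> w)"
  shows "\<forall>\<^sub>F s in at_right 0. u x < u (x + s *\<^sub>R v + (s * s) *\<^sub>R w)"
proof -
  define \<gamma> where "\<gamma> s = x + s *\<^sub>R v + (s * s) *\<^sub>R w" for s :: real
  define g' where "g' s = gradient u (\<gamma> s) \<bullet> (v + (2 * s) *\<^sub>R w)" for s
  have \<gamma>0: "\<gamma> 0 = x" by (simp add: \<gamma>_def)
  have der_\<gamma>: "(\<gamma> has_derivative (\<lambda>h. h *\<^sub>R (v + (2 * s) *\<^sub>R w))) (at s)" for s
    unfolding \<gamma>_def[abs_def] by (rule parabola_derivative)
  have "isCont \<gamma> 0" using has_derivative_continuous[OF der_\<gamma>] .
  then have "(\<gamma> \<longlongrightarrow> \<gamma> 0) (nhds 0)"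
    by (simp only: isCont_def tendsto_at_iff_tendsto_nhds)
  then have "\<forall>\<^sub>F s in nhds 0. \<gamma> s \<in> S"
    by (rule topological_tendstoD) (use S \<gamma>0 in simp_all)
  then obtain d where d: "0 < d" "\<And>s. \<bar>s\<bar> < d \<Longrightarrow> \<gamma> s \<in> S"
    unfolding eventually_nhds_metric by (auto simp: dist_real_def)
  have "((\<lambda>s. u (\<gamma> s)) has_real_derivative g' s) (at s)" if "\<bar>s\<bar> < d" for s
  proof -
    have "((\<lambda>s. u (\<gamma> s)) has_derivative (\<lambda>h. gradient u (\<gamma> s) \<bullet> (h *\<^sub>R (v + (2 * s) *\<^sub>R w)))) (at s)"
      by (rule has_derivative_compose[OF der_\<gamma> gradient_has_derivative_C1[OF u d(2)[OF that]]])
    then show ?thesis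
      by (simp add: has_field_derivative_def g'_def mult_commute_abs)
  qed
  moreover have "g' 0 = 0" using v by (simp add: g'_def \<gamma>0)
  moreover have "(g' has_real_derivative v \<bullet> (hessian u x *v v) + 2 * (gradient u x \<bullet> w)) (at 0)"
  proof -
    have "(gradient u has_derivative (\<lambda>h. hessian u x *v h)) (at (\<gamma> 0))"
      using hessian_has_derivative[OF S u] by (simp add: \<gamma>0)
    from has_derivative_compose[OF der_\<gamma> this]
    have "((\<lambda>s. gradient u (\<gamma> s)) has_derivative (\<lambda>h. hessian u x *v (h *\<^sub>R v))) (at 0)"
      by simp
    moreover have "((\<lambda>s. v + (2 * s) *\<^sub>R w) has_derivative (\<lambda>h. (2 * h) *\<^sub>R w)) (at 0)"
      by (auto intro!: derivative_eq_intros)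
    ultimately have "(g' has_derivative
        (\<lambda>h. gradient u (\<gamma> 0) \<bullet> ((2 * h) *\<^sub>R w) + (hessian u x *v (h *\<^sub>R v)) \<bullet> (v + (2 * 0) *\<^sub>R w))) (at 0)"
      unfolding g'_def[abs_def] by (rule has_derivative_inner)
    moreover have "gradient u (\<gamma> 0) \<bullet> ((2 * h) *\<^sub>R w) + (hessian u x *v (h *\<^sub>R v)) \<bullet> (v + (2 * 0) *\<^sub>R w)
        = (v \<bullet> (hessian u x *v v) + 2 * (gradient u x \<bullet> w)) * h" for h
      by (simp add: \<gamma>0 matrix_vector_mult_scaleR algebra_simps inner_commute[of v])
    ultimately show ?thesis by (simp add: has_field_derivative_def)
  qed
  ultimately have "\<forall>\<^sub>F s in at_right 0. u (\<gamma> 0) < u (\<gamma> s)"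
    using increasing_of_second_derivative[where g = "\<lambda>s. u (\<gamma> s)" and g' = g', OF d(1) _ _ _ pos]
    by simp
  then show ?thesis by (simp add: \<gamma>_def)
qed

lemma growth_along_line:
  assumes "(u has_derivative (\<lambda>h. gradient u x \<bullet> h)) (at x)" "0 < gradient u x \<bullet> w"
  shows "\<forall>\<^sub>F s in at_right 0. u x < u (x + s *\<^sub>R w)"
proof -
  have "((\<lambda>s. u (x + s *\<^sub>R w)) has_real_derivative gradient u x \<bullet> w) (at 0)"
    by (rule line_derivative) (use assms(1) in simp)
  from DERIV_pos_inc_right[OF this assms(2)]
  obtain d where "d > 0" "\<And>h. 0 < h \<Longrightarrow> h < d \<Longrightarrow> u x < u (x + h *\<^sub>R w)" by auto
  then show ?thesis by (intro eventually_at_rightI[of 0 d]) simp_all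
qed

text \<open>The part of \<open>N\<close> orthogonal to \<open>g\<close> vanishes: otherwise subtracting it from a small multiple of \<open>g\<close> gives a
  vector of the half space on which \<open>N\<close> is negative.\<close>

lemma sgn_eq_of_halfspace:
  fixes g N :: "'a::real_inner"
  assumes "g \<noteq> 0" "N \<noteq> 0" and half: "\<And>w. 0 < g \<bullet> w \<Longrightarrow> 0 \<le> N \<bullet> w"
  shows "sgn N = sgn g"
proof -
  define \<alpha> where "\<alpha> = (N \<bullet> g) / (g \<bullet> g)"
  define v where "v = N - \<alpha> *\<^sub>R g"
  have gg: "g \<bullet> g > 0" using assms(1) by simp
  have gv: "g \<bullet> v = 0" using gg by (simp add: v_def \<alpha>_def inner_diff_right inner_commute)
  have N: "N = \<alpha> *\<^sub>R g + v" by (simp add: v_def)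
  have "v \<bullet> v \<le> \<alpha> * (g \<bullet> g) * e" if "e > 0" for e
  proof -
    have "0 \<le> N \<bullet> (e *\<^sub>R g - v)" using gv gg that by (intro half) (simp add: inner_diff_right)
    then show ?thesis using gv by (simp add: N inner_diff_right inner_add_left inner_commute[of v g] algebra_simps)
  qed
  note e = this
  have "v \<bullet> v \<le> 0"
  proof (rule ccontr)
    assume "\<not> v \<bullet> v \<le> 0"
    then have vv: "0 < v \<bullet> v" by linarith
    moreover have "v \<bullet> v \<le> \<alpha> * (g \<bullet> g)" using e[of 1] by simp
    ultimately have a: "\<alpha> * (g \<bullet> g) > 0" by linarith
    have "v \<bullet> v \<le> \<alpha> * (g \<bullet> g) * ((v \<bullet> v) / (2 * (\<alpha> * (g \<bullet> g))))"
      by (rule e, rule divide_pos_pos) (use a vv in linarith)+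
    also have "\<dots> = (v \<bullet> v) / 2" using less_imp_neq[OF a] by simp
    finally show False using vv by linarith
  qed
  then have "v = 0" by (metis inner_eq_zero_iff inner_ge_zero order_antisym)
  then have "N = \<alpha> *\<^sub>R g" using N by simp
  moreover have "0 \<le> N \<bullet> g" by (rule half[OF gg])
  ultimately have "\<alpha> > 0" using gg assms(2) by (simp add: zero_le_mult_iff less_le)
  then show ?thesis using \<open>N = \<alpha> *\<^sub>R g\<close> by (simp add: sgn_scaleR)
qed

lemma second_fundamental_form_tangent:
  assumes S: "open S" "p \<in> S" and \<phi>: "Ck_on (Suc (Suc 0)) \<phi> S"
    and g: "gradient \<phi> p \<noteq> 0" and v: "v \<bullet> gradient \<phi> p = 0"
  shows "second_fundamental_form \<phi> p v v = (v \<bullet> (hessian \<phi> p *v v)) / norm (gradient \<phi> p)"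
proof -
  define G where "G = gradient \<phi> p"
  have dG: "(gradient \<phi> has_derivative (\<lambda>h. hessian \<phi> p *v h)) (at p)"
    by (rule hessian_has_derivative[OF S \<phi>])
  have "((\<lambda>y. norm (gradient \<phi> y)) has_derivative (\<lambda>h. sgn G \<bullet> (hessian \<phi> p *v h))) (at p)"
    using has_derivative_compose[OF dG has_derivative_norm[OF g]] g
    by (simp add: G_def inner_commute)
  from Deriv.has_derivative_inverse[OF _ this]
  have "((\<lambda>y. inverse (norm (gradient \<phi> y))) has_derivative
      (\<lambda>h. - (inverse (norm G) * (sgn G \<bullet> (hessian \<phi> p *v h)) * inverse (norm G)))) (at p)"
    using g by (simp add: G_def)
  from has_derivative_scaleR[OF this dG]
  have d: "((\<lambda>y. sgn (gradient \<phi> y)) has_derivative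
      (\<lambda>h. inverse (norm G) *\<^sub>R (hessian \<phi> p *v h)
         + (- (inverse (norm G) * (sgn G \<bullet> (hessian \<phi> p *v h)) * inverse (norm G))) *\<^sub>R G)) (at p)"
    by (simp only: sgn_div_norm G_def)
  have "G \<bullet> v = 0" using v by (simp add: G_def inner_commute)
  then show ?thesis
    unfolding second_fundamental_form_def frechet_derivative_at[OF d, symmetric] G_def[symmetric]
    by (simp add: inner_diff_right inner_add_right inner_commute[of _ v] divide_inverse mult.commute)
qed

text \<open>Since \<open>\<phi>\<close> is negative where \<open>u\<close> exceeds \<open>u p\<close>, the two gradients at \<open>p\<close> have opposite directions. If
  the Hessian of \<open>u\<close> were nonnegative in a tangent direction \<open>v\<close>, then \<open>u\<close> would grow along the parabola
  in direction \<open>v\<close> with an arbitrarily small bending towards larger \<open>u\<close>. Because \<open>\<phi>\<close> is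
  strictly convex in the direction \<open>v\<close>, it would grow along that parabola too, although it has to be negative
  where \<open>u\<close> exceeds \<open>u p\<close>.\<close>

lemma hessian_negative_on_level_set:
  assumes U: "open U" "p \<in> U" and V: "open V" "p \<in> V"
    and u: "Ck_on (Suc (Suc 0)) u V" and \<phi>: "Ck_on (Suc (Suc 0)) \<phi> U"
    and nz: "gradient u p \<noteq> 0" "gradient \<phi> p \<noteq> 0"
    and level: "\<phi> p = 0" "\<And>x. x \<in> U \<Longrightarrow> x \<in> V \<Longrightarrow> u p < u x \<Longrightarrow> \<phi> x < 0"
    and convex: "\<And>v. v \<noteq> 0 \<Longrightarrow> v \<bullet> gradient \<phi> p = 0 \<Longrightarrow> 0 < second_fundamental_form \<phi> p v v"
    and v: "v \<noteq> 0" "v \<bullet> gradient u p = 0"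
  shows "v \<bullet> (hessian u p *v v) < 0"
proof (rule ccontr)
  assume "\<not> v \<bullet> (hessian u p *v v) < 0"
  then have vHv: "0 \<le> v \<bullet> (hessian u p *v v)" by simp
  define g where "g = gradient u p"
  have du: "(u has_derivative (\<lambda>h. gradient u p \<bullet> h)) (at p)"
    by (rule gradient_has_derivative_C1[OF u V(2)])
  have d\<phi>: "(\<phi> has_derivative (\<lambda>h. gradient \<phi> p \<bullet> h)) (at p)"
    by (rule gradient_has_derivative_C1[OF \<phi> U(2)])
  have near: "\<forall>\<^sub>F s in at_right 0. \<gamma> s \<in> U \<and> \<gamma> s \<in> V"
    if "isCont \<gamma> 0" "\<gamma> 0 = p" for \<gamma> :: "real \<Rightarrow> real^'a"
  proof -
    have "(\<gamma> \<longlongrightarrow> p) (at_right 0)"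
      using that(1) unfolding isCont_def that(2) by (rule tendsto_within_subset) simp
    then show ?thesis
      using U V by (intro eventually_conj) (auto dest: topological_tendstoD)
  qed
  have below: "\<forall>\<^sub>F s in at_right 0. \<phi> (\<gamma> s) < 0"
    if "isCont \<gamma> 0" "\<gamma> 0 = p" "\<forall>\<^sub>F s in at_right 0. u p < u (\<gamma> s)" for \<gamma> :: "real \<Rightarrow> real^'a"
    using near[OF that(1,2)] that(3) by eventually_elim (use level(2) in blast)
  have clash: False if "\<forall>\<^sub>F s in at_right (0::real). \<phi> (\<gamma> s) < 0"
    "\<forall>\<^sub>F s in at_right 0. \<phi> p < \<phi> (\<gamma> s)" for \<gamma> :: "real \<Rightarrow> real^'a"
  proof -
    have "\<forall>\<^sub>F s in at_right (0::real). False"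
      using that by eventually_elim (simp add: level(1))
    then show False by simp
  qed
  have "sgn (- gradient \<phi> p) = sgn g"
  proof (rule sgn_eq_of_halfspace)
    fix w assume w: "0 < g \<bullet> w"
    have "isCont (\<lambda>s. p + s *\<^sub>R w) 0" by (intro continuous_intros)
    from below[OF this _ growth_along_line[OF du]] w
    have b: "\<forall>\<^sub>F s in at_right 0. \<phi> (p + s *\<^sub>R w) < 0" by (simp add: g_def)
    show "0 \<le> - gradient \<phi> p \<bullet> w"
    proof (rule ccontr)
      assume "\<not> 0 \<le> - gradient \<phi> p \<bullet> w"
      then have "0 < gradient \<phi> p \<bullet> w" by simp
      from clash[OF b growth_along_line[OF d\<phi> this]] show False .
    qed
  qed (use nz in \<open>simp_all add: g_def\<close>)
  moreover have "g = norm g *\<^sub>R sgn g" using nz(1) by (simp add: g_def sgn_div_norm)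
  ultimately have "g = norm g *\<^sub>R sgn (- gradient \<phi> p)" by simp
  then obtain k where k: "g = k *\<^sub>R gradient \<phi> p"
    using that[of "- norm g * inverse (norm (gradient \<phi> p))"] by (simp add: sgn_div_norm)
  have "k \<noteq> 0" using k nz by (auto simp: g_def)
  then have vg: "v \<bullet> gradient \<phi> p = 0" using v(2) k by (simp add: g_def)
  have "0 < v \<bullet> (hessian \<phi> p *v v)"
    using convex[OF v(1) vg] second_fundamental_form_tangent[OF U \<phi> nz(2) vg] nz(2)
    by (simp add: zero_less_divide_iff)
  define K where "K = 1 + \<bar>gradient \<phi> p \<bullet> g\<bar>"
  have K: "0 < K" by (simp add: K_def add_pos_nonneg)
  \<comment> \<open>small enough for the bending term not to compensate the convexity of \<open>\<phi>\<close>\<close>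
  define c where "c = (v \<bullet> (hessian \<phi> p *v v)) / (4 * K)"
  have c: "0 < c" using \<open>0 < v \<bullet> (hessian \<phi> p *v v)\<close> K by (simp add: c_def)
  have "0 < v \<bullet> (hessian u p *v v) + 2 * (gradient u p \<bullet> (c *\<^sub>R g))"
    using vHv c nz(1) by (simp add: g_def add_nonneg_pos)
  moreover have "gradient u p \<bullet> v = 0" using v(2) by (simp add: inner_commute)
  ultimately have "\<forall>\<^sub>F s in at_right 0. u p < u (p + s *\<^sub>R v + (s * s) *\<^sub>R (c *\<^sub>R g))"
    by (intro growth_along_parabola[OF V u])
  moreover have "isCont (\<lambda>s. p + s *\<^sub>R v + (s * s) *\<^sub>R (c *\<^sub>R g)) 0" by (intro continuous_intros)
  ultimately have b: "\<forall>\<^sub>F s in at_right 0. \<phi> (p + s *\<^sub>R v + (s * s) *\<^sub>R (c *\<^sub>R g)) < 0"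
    by (intro below) simp_all
  have "\<bar>2 * (gradient \<phi> p \<bullet> (c *\<^sub>R g))\<bar> < v \<bullet> (hessian \<phi> p *v v)"
  proof -
    have "\<bar>2 * (gradient \<phi> p \<bullet> (c *\<^sub>R g))\<bar> = 2 * c * \<bar>gradient \<phi> p \<bullet> g\<bar>"
      using c by (simp add: abs_mult)
    also have "\<dots> < 4 * c * K"
      by (rule mult_strict_mono) (use c in \<open>simp_all add: K_def\<close>)
    also have "\<dots> = v \<bullet> (hessian \<phi> p *v v)" using K by (simp add: c_def)
    finally show ?thesis .
  qed
  then have "0 < v \<bullet> (hessian \<phi> p *v v) + 2 * (gradient \<phi> p \<bullet> (c *\<^sub>R g))" by linarith
  moreover have "gradient \<phi> p \<bullet> v = 0" using vg by (simp add: inner_commute)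
  ultimately have "\<forall>\<^sub>F s in at_right 0. \<phi> p < \<phi> (p + s *\<^sub>R v + (s * s) *\<^sub>R (c *\<^sub>R g))"
    by (intro growth_along_parabola[OF U \<phi>])
  from clash[OF b this] show False .
qed

section \<open>Symmetric matrices with one positive direction\<close>

lemma inner_matrix_vector_mult:
  fixes A :: "real^'n::finite^'n"
  shows "v \<bullet> (A *v w) = (\<Sum>i\<in>UNIV. \<Sum>j\<in>UNIV. A $ i $ j * (v $ i * w $ j))"
  by (simp add: inner_vec_def matrix_vector_mult_def sum_distrib_left mult.commute mult.left_commute)

lemma quadratic_form_rank_one:
  fixes b :: "real^'n::finite"
  shows "v \<bullet> ((\<chi> i j. b $ i * b $ j) *v v) = (b \<bullet> v)^2"
  unfolding inner_matrix_vector_mult by (simp add: inner_vec_def power2_eq_square sum_product mult_ac)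

text \<open>If the diagonal entry vanished, the form would be affine with nonzero slope along the line
  \<open>s e\<^sub>k + e\<^sub>j\<close> for some \<open>j\<close>, and would take negative values there.\<close>

lemma positive_semidefinite_diagonal:
  fixes B :: "real^'n::finite^'n"
  assumes sym: "transpose B = B" and psd: "\<And>v. 0 \<le> v \<bullet> (B *v v)" and "B $ k \<noteq> 0"
  shows "0 < B $ k $ k"
proof (rule ccontr)
  assume "\<not> 0 < B $ k $ k"
  moreover have "0 \<le> B $ k $ k"
    using psd[of "axis k 1"] by (simp add: inner_axis' matrix_vector_mul_component inner_axis)
  ultimately have kk: "B $ k $ k = 0" by simp
  obtain j where j: "B $ k $ j \<noteq> 0" using assms(3) by (auto simp: vec_eq_iff)
  have kj: "B $ j $ k = B $ k $ j" using sym by (metis transpose_def vec_lambda_beta)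
  \<comment> \<open>the form is affine in \<open>s\<close>, and this \<open>s\<close> gives it the value \<open>- 1\<close>\<close>
  define s where "s = - (B $ j $ j + 1) / (2 * B $ k $ j)"
  have "(s *\<^sub>R axis k 1 + axis j 1) \<bullet> (B *v (s *\<^sub>R axis k 1 + axis j 1)) = s * (2 * B $ k $ j) + B $ j $ j"
    using kk kj by (simp add: matrix_vector_right_distrib matrix_vector_mult_scaleR inner_add_left
        inner_add_right inner_axis' matrix_vector_mul_component inner_axis)
  also have "\<dots> = - 1" using j by (simp add: s_def)
  finally show False using psd[of "s *\<^sub>R axis k 1 + axis j 1"] by simp
qed

text \<open>Splitting off rank one terms as in the Cholesky decomposition writes \<open>B\<close> as a sum of
  matrices \<open>b b\<^sup>T\<close>, and each of them contributes \<open>b \<bullet> (a b)\<close> to the trace of \<open>a B\<close>.\<close>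

lemma trace_product_positive:
  fixes a B :: "real^'n::finite^'n"
  assumes a: "positive_definite a"
    and "transpose B = B" "\<And>v. 0 \<le> v \<bullet> (B *v v)" "B \<noteq> 0"
  shows "0 < (\<Sum>i\<in>UNIV. \<Sum>j\<in>UNIV. a $ i $ j * B $ i $ j)"
  using assms(2-)
proof (induction "card {i. B $ i \<noteq> 0}" arbitrary: B rule: less_induct)
  case less
  note sym = less.prems(1) and psd = less.prems(2)
  have Bsym: "B $ i $ j = B $ j $ i" for i j
    using sym by (metis transpose_def vec_lambda_beta)
  obtain k where k: "B $ k \<noteq> 0" using less.prems(3) by (auto simp: vec_eq_iff)
  define \<beta> where "\<beta> = B $ k $ k"
  have \<beta>: "0 < \<beta>" unfolding \<beta>_def by (rule positive_semidefinite_diagonal[OF sym psd k])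
  define b where "b = (1 / sqrt \<beta>) *\<^sub>R B $ k"
  have b: "b \<noteq> 0" using k \<beta> by (simp add: b_def)
  have bb: "b $ i * b $ j = B $ k $ i * B $ k $ j / \<beta>" for i j
    using \<beta> by (simp add: b_def)
  define B' where "B' = B - (\<chi> i j. b $ i * b $ j)"
  have B'_nth: "B' $ i $ j = B $ i $ j - B $ k $ i * B $ k $ j / \<beta>" for i j
    by (simp add: B'_def bb)
  have sym': "transpose B' = B'"
  proof -
    have "B' $ j $ i = B' $ i $ j" for i j
      unfolding B'_nth using Bsym[of j i] by (simp add: mult.commute)
    then show ?thesis by (simp add: transpose_def vec_eq_iff)
  qed
  have psd': "0 \<le> v \<bullet> (B' *v v)" for v
  proof -
    define t where "t = (B $ k \<bullet> v) / \<beta>"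
    have Bv: "axis k 1 \<bullet> (B *v v) = \<beta> * t"
      using \<beta> by (simp add: t_def inner_axis' matrix_vector_mul_component)
    have vB: "v \<bullet> (B *v axis k 1) = \<beta> * t"
    proof -
      have "v \<bullet> (B *v axis k 1) = (\<Sum>i\<in>UNIV. v $ i * B $ i $ k)"
        by (simp add: matrix_vector_mult_basis column_def inner_vec_def)
      also have "\<dots> = B $ k \<bullet> v" by (simp add: inner_vec_def Bsym[of k] mult.commute)
      finally show ?thesis using \<beta> by (simp add: t_def)
    qed
    have BB: "axis k 1 \<bullet> (B *v axis k 1) = \<beta>"
      by (simp add: \<beta>_def inner_axis' matrix_vector_mul_component inner_axis)
    have "0 \<le> (v - t *\<^sub>R axis k 1) \<bullet> (B *v (v - t *\<^sub>R axis k 1))" by (rule psd)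
    also have "\<dots> = v \<bullet> (B *v v) - \<beta> * t^2"
      by (simp add: matrix_vector_mult_diff_distrib matrix_vector_mult_scaleR inner_diff_left
          inner_diff_right Bv vB BB power2_eq_square)
    also have "\<beta> * t^2 = (b \<bullet> v)^2"
      using \<beta> by (simp add: t_def b_def power_divide power2_eq_square)
    finally show ?thesis
      by (simp add: B'_def matrix_vector_mult_diff_rdistrib inner_diff_right quadratic_form_rank_one)
  qed
  have "{i. B' $ i \<noteq> 0} \<subset> {i. B $ i \<noteq> 0}"
  proof
    show "{i. B' $ i \<noteq> 0} \<subseteq> {i. B $ i \<noteq> 0}"
    proof (intro Collect_mono impI notI)
      fix i assume "B $ i = 0" "B' $ i \<noteq> 0"
      then show False using Bsym[of k i] by (simp add: vec_eq_iff B'_nth)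
    qed
    have "B' $ k = 0" using \<beta> by (simp add: vec_eq_iff B'_nth \<beta>_def)
    then show "{i. B' $ i \<noteq> 0} \<noteq> {i. B $ i \<noteq> 0}" using k by blast
  qed
  then have smaller: "card {i. B' $ i \<noteq> 0} < card {i. B $ i \<noteq> 0}"
    by (intro psubset_card_mono) simp_all
  have "0 \<le> (\<Sum>i\<in>UNIV. \<Sum>j\<in>UNIV. a $ i $ j * B' $ i $ j)"
  proof (cases "B' = 0")
    case False
    from less.hyps[OF smaller sym' psd' this] show ?thesis by simp
  qed simp
  moreover have "0 < b \<bullet> (a *v b)" using a b by (simp add: positive_definite_def)
  moreover have "(\<Sum>i\<in>UNIV. \<Sum>j\<in>UNIV. a $ i $ j * B $ i $ j)
      = (\<Sum>i\<in>UNIV. \<Sum>j\<in>UNIV. a $ i $ j * B' $ i $ j) + b \<bullet> (a *v b)"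
    by (simp add: inner_matrix_vector_mult B'_def algebra_simps flip: sum.distrib)
  ultimately show ?case by linarith
qed

text \<open>If \<open>A\<close> had no positive direction, then \<open>- A\<close> would be positive semidefinite and nonzero, which
  makes the trace of \<open>a A\<close> negative.\<close>

lemma positive_direction_of_trace_zero:
  fixes a A :: "real^'n::finite^'n"
  assumes "positive_definite a" "transpose A = A" "A \<noteq> 0"
    and trace: "(\<Sum>i\<in>UNIV. \<Sum>j\<in>UNIV. a $ i $ j * A $ i $ j) = 0"
  shows "\<exists>w. 0 < w \<bullet> (A *v w)"
proof (rule ccontr)
  assume "\<not> ?thesis"
  then have "w \<bullet> (A *v w) \<le> 0" for w by (simp add: not_less)
  then have psd: "0 \<le> w \<bullet> ((- A) *v w)" for w
    by (simp add: inner_matrix_vector_mult sum_negf)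
  have "transpose (- A) = - A" using assms(2) by (simp add: transpose_def vec_eq_iff)
  from trace_product_positive[OF assms(1) this psd] assms(3) trace
  show False by (simp add: sum_negf)
qed

text \<open>This is signature \<open>(1, n - 1)\<close> with a chosen negative hyperplane \<open>\<nu>\<^sup>\<bottom>\<close>. The positive direction may be
  anywhere, as this is what the differential equation provides; \<open>\<nu>\<close> itself need not be one.\<close>

definition lorentzian :: "real^'n::finite^'n \<Rightarrow> real^'n \<Rightarrow> bool" where
  "lorentzian A \<nu> \<longleftrightarrow> transpose A = A \<and>
    (\<forall>v. v \<noteq> 0 \<and> v \<bullet> \<nu> = 0 \<longrightarrow> v \<bullet> (A *v v) < 0) \<and> (\<exists>w. 0 < w \<bullet> (A *v w))"

lemma symmetric_inner:
  fixes A :: "real^'n::finite^'n"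
  assumes "transpose A = A"
  shows "v \<bullet> (A *v w) = w \<bullet> (A *v v)"
  using assms by (metis dot_lmul_matrix inner_commute transpose_matrix_vector)

text \<open>A vector \<open>z\<close> with \<open>A z = \<nu>\<close> is orthogonal to the hyperplane \<open>\<nu>\<^sup>\<bottom>\<close> for the form \<open>A\<close>.
  Were \<open>A\<close> not positive on \<open>z\<close>, it would be nonpositive on all of space.\<close>

lemma lorentzian_preimage_of_normal:
  assumes A: "lorentzian A \<nu>" and "\<nu> \<noteq> 0" and z: "A *v z = \<nu>"
  shows "0 < z \<bullet> \<nu>"
proof -
  have sym: "transpose A = A" and neg: "\<And>v. v \<noteq> 0 \<Longrightarrow> v \<bullet> \<nu> = 0 \<Longrightarrow> v \<bullet> (A *v v) < 0"
    using A by (auto simp: lorentzian_def)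
  obtain w where w: "0 < w \<bullet> (A *v w)" using A by (auto simp: lorentzian_def)
  have z\<nu>: "z \<bullet> \<nu> \<noteq> 0"
  proof
    assume 0: "z \<bullet> \<nu> = 0"
    have "z = 0" using neg[OF _ 0] 0 z by auto
    then show False using z assms(2) by simp
  qed
  define c where "c = (w \<bullet> \<nu>) / (z \<bullet> \<nu>)"
  define v where "v = w - c *\<^sub>R z"
  have v\<nu>: "v \<bullet> \<nu> = 0" using z\<nu> by (simp add: v_def c_def inner_diff_left)
  have w_eq: "w = v + c *\<^sub>R z" by (simp add: v_def)
  have "w \<bullet> (A *v w) = v \<bullet> (A *v v) + c^2 * (z \<bullet> \<nu>)"
    using v\<nu> symmetric_inner[OF sym, of z v]
    by (simp add: w_eq matrix_vector_right_distrib matrix_vector_mult_scaleR inner_add_left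
        inner_add_right z power2_eq_square)
  moreover have "v \<bullet> (A *v v) \<le> 0" using neg[OF _ v\<nu>] by (cases "v = 0") auto
  ultimately have "0 < c^2 * (z \<bullet> \<nu>)" using w by linarith
  then show ?thesis by (simp add: zero_less_mult_iff)
qed

text \<open>A nonzero kernel vector would not be in the negative hyperplane. Every vector would then be the sum of
  one in that hyperplane and one in the kernel, and the form would be nowhere positive.\<close>

lemma lorentzian_det_nonzero:
  assumes A: "lorentzian A \<nu>"
  shows "det A \<noteq> 0"
proof -
  have sym: "transpose A = A" and neg: "\<And>v. v \<noteq> 0 \<Longrightarrow> v \<bullet> \<nu> = 0 \<Longrightarrow> v \<bullet> (A *v v) < 0"
    using A by (auto simp: lorentzian_def)
  obtain w where w: "0 < w \<bullet> (A *v w)" using A by (auto simp: lorentzian_def)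
  have "z = 0" if z: "A *v z = 0" for z
  proof (rule ccontr)
    assume "z \<noteq> 0"
    then have z\<nu>: "z \<bullet> \<nu> \<noteq> 0" using neg[of z] z by auto
    define c where "c = (w \<bullet> \<nu>) / (z \<bullet> \<nu>)"
    define v where "v = w - c *\<^sub>R z"
    have v\<nu>: "v \<bullet> \<nu> = 0" using z\<nu> by (simp add: v_def c_def inner_diff_left)
    have w_eq: "w = v + c *\<^sub>R z" by (simp add: v_def)
    have "w \<bullet> (A *v w) = v \<bullet> (A *v v)"
      using symmetric_inner[OF sym, of z v]
      by (simp add: w_eq matrix_vector_right_distrib matrix_vector_mult_scaleR inner_add_left
          inner_add_right z)
    moreover have "v \<bullet> (A *v v) \<le> 0" using neg[OF _ v\<nu>] by (cases "v = 0") auto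
    ultimately show False using w by linarith
  qed
  then have "inj ((*v) A)"
    using linear_injective_0[OF matrix_vector_mul_linear[of A]] by blast
  then show ?thesis
    using det_nz_iff_inj[OF matrix_vector_mul_linear[of A]] by (simp add: matrix_of_matrix_vector_mul)
qed

lemma det_segment_same_sign:
  fixes A B :: "real^'n::finite^'n"
  assumes "\<And>t. 0 \<le> t \<Longrightarrow> t \<le> 1 \<Longrightarrow> det ((1 - t) *\<^sub>R A + t *\<^sub>R B) \<noteq> 0"
  shows "0 < det A * det B"
proof (rule ccontr)
  define f where "f t = det ((1 - t) *\<^sub>R A + t *\<^sub>R B)" for t
  have "Ck_on 0 (\<lambda>t. ((1 - t) *\<^sub>R A + t *\<^sub>R B) $ i $ j) (UNIV :: real set)" for i j
    by (auto intro!: continuous_intros)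
  from Ck_on_det[OF open_UNIV this] have "continuous_on UNIV f" by (simp add: f_def[abs_def])
  then have cont: "continuous_on {0..1} f" by (rule continuous_on_subset) simp
  have f: "f 0 = det A" "f 1 = det B" by (simp_all add: f_def)
  assume "\<not> 0 < det A * det B"
  then have "(f 0 \<le> 0 \<and> 0 \<le> f 1) \<or> (f 1 \<le> 0 \<and> 0 \<le> f 0)"
    by (auto simp: f zero_less_mult_iff not_less)
  then obtain t where "0 \<le> t" "t \<le> 1" "f t = 0"
    using IVT'[of f 0 0 1] IVT2'[of f 1 0 0] cont by auto
  then show False using assms[of t] by (simp add: f_def)
qed

text \<open>A common positive direction is what keeps the segment Lorentzian: without it, the positive directions
  of the two ends could cancel.\<close>

lemma lorentzian_convex_combination:
  fixes A B :: "real^'n::finite^'n"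
  assumes A: "lorentzian A \<nu>" and B: "lorentzian B \<nu>"
    and w: "0 < w \<bullet> (A *v w)" "0 < w \<bullet> (B *v w)" and t: "0 \<le> t" "t \<le> 1"
  shows "lorentzian ((1 - t) *\<^sub>R A + t *\<^sub>R B) \<nu>"
proof -
  have q: "v \<bullet> (((1 - t) *\<^sub>R A + t *\<^sub>R B) *v v) = (1 - t) * (v \<bullet> (A *v v)) + t * (v \<bullet> (B *v v))" for v
    by (simp add: matrix_vector_mult_add_rdistrib inner_add_right flip: scaleR_matrix_vector_assoc)
  have mix: "0 < (1 - t) * x + t * y" if "0 < x" "0 < y" for x y
    using t that by (cases "t = 0") (auto intro!: add_nonneg_pos)
  have "transpose ((1 - t) *\<^sub>R A + t *\<^sub>R B) = (1 - t) *\<^sub>R A + t *\<^sub>R B"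
    using A B by (simp add: lorentzian_def transpose_def vec_eq_iff)
  moreover have "(1 - t) * (v \<bullet> (A *v v)) + t * (v \<bullet> (B *v v)) < 0" if "v \<noteq> 0" "v \<bullet> \<nu> = 0" for v
    using mix[of "- (v \<bullet> (A *v v))" "- (v \<bullet> (B *v v))"] A B that by (auto simp: lorentzian_def)
  ultimately show ?thesis using mix[OF w] by (auto simp: lorentzian_def q)
qed

lemma lorentzian_det_same_sign:
  fixes A B :: "real^'n::finite^'n"
  assumes "lorentzian A \<nu>" "lorentzian B \<nu>" "0 < w \<bullet> (A *v w)" "0 < w \<bullet> (B *v w)"
  shows "0 < det A * det B"
  by (rule det_segment_same_sign)
    (rule lorentzian_det_nonzero[OF lorentzian_convex_combination[OF assms]])

lemma lorentzian_add_rank_one: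
  fixes A :: "real^'n::finite^'n"
  assumes A: "lorentzian A \<nu>" and "0 \<le> c"
  shows "lorentzian (A + c *\<^sub>R (\<chi> i j. \<nu> $ i * \<nu> $ j)) \<nu>"
    and "v \<bullet> ((A + c *\<^sub>R (\<chi> i j. \<nu> $ i * \<nu> $ j)) *v v) = v \<bullet> (A *v v) + c * (\<nu> \<bullet> v)^2"
proof -
  let ?B = "A + c *\<^sub>R (\<chi> i j. \<nu> $ i * \<nu> $ j)"
  have q: "v \<bullet> (?B *v v) = v \<bullet> (A *v v) + c * (\<nu> \<bullet> v)^2" for v
    by (simp add: matrix_vector_mult_add_rdistrib inner_add_right quadratic_form_rank_one
        flip: scaleR_matrix_vector_assoc)
  then show "v \<bullet> (?B *v v) = v \<bullet> (A *v v) + c * (\<nu> \<bullet> v)^2" .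
  have "transpose A = A" using A by (simp add: lorentzian_def)
  then have "A $ i $ j = A $ j $ i" for i j by (metis transpose_def vec_lambda_beta)
  then have "transpose ?B = ?B" by (simp add: transpose_def vec_eq_iff mult.commute)
  moreover have "v \<bullet> (?B *v v) < 0" if "v \<noteq> 0" "v \<bullet> \<nu> = 0" for v
    using A that by (simp add: q lorentzian_def inner_commute)
  moreover obtain w where "0 < w \<bullet> (A *v w)" using A by (auto simp: lorentzian_def)
  then have "0 < w \<bullet> (?B *v w)" using assms(2) by (simp add: q add_pos_nonneg)
  ultimately show "lorentzian ?B \<nu>" unfolding lorentzian_def by blast
qed

definition reflection_matrix :: "'n::finite \<Rightarrow> real^'n^'n" where
  "reflection_matrix k = (\<chi> i j. if i = j then (if i = k then 1 else - 1) else 0)"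

lemma det_reflection_matrix: "det (reflection_matrix (k :: 'n::finite)) = (- 1) ^ (CARD('n) - 1)"
proof -
  have "det (reflection_matrix k) = (\<Prod>i\<in>UNIV. if i = k then 1 else - 1)"
    by (subst det_diagonal) (simp_all add: reflection_matrix_def)
  also have "\<dots> = (\<Prod>i\<in>UNIV - {k}. - 1)"
    by (subst prod.remove[of _ k]) (auto intro!: prod.cong)
  finally show ?thesis by (simp add: card_Diff_singleton)
qed

lemma reflection_matrix_quadratic:
  "v \<bullet> (reflection_matrix k *v v) = 2 * (v $ k)^2 - v \<bullet> v"
proof -
  have "(reflection_matrix k *v v) $ i = 2 * (if i = k then v $ k else 0) - v $ i" for i
    by (simp add: reflection_matrix_def matrix_vector_mult_def if_distrib[of "\<lambda>x. x * _"] sum.delta cong: if_cong)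
  then have "v \<bullet> (reflection_matrix k *v v) = (\<Sum>i\<in>UNIV. v $ i * (2 * (if i = k then v $ k else 0) - v $ i))"
    by (simp add: inner_vec_def)
  also have "\<dots> = (\<Sum>i\<in>UNIV. (if i = k then 2 * (v $ k * v $ k) else 0) - v $ i * v $ i)"
    by (intro sum.cong) (simp_all add: algebra_simps)
  also have "\<dots> = 2 * (v $ k * v $ k) - (\<Sum>i\<in>UNIV. v $ i * v $ i)"
    by (simp add: sum_subtractf sum.delta)
  finally show ?thesis by (simp add: inner_vec_def power2_eq_square)
qed

lemma lorentzian_reflection_matrix: "lorentzian (reflection_matrix k) (axis k 1)"
proof -
  have "transpose (reflection_matrix k) = reflection_matrix k"
    by (simp add: reflection_matrix_def transpose_def vec_eq_iff)
  moreover have "0 < axis k 1 \<bullet> (reflection_matrix k *v axis k 1)"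
    by (simp add: reflection_matrix_quadratic)
  moreover have "v \<bullet> (reflection_matrix k *v v) < 0" if "v \<noteq> 0" "v \<bullet> axis k 1 = 0" for v
    using that by (simp add: reflection_matrix_quadratic inner_axis)
  ultimately show ?thesis unfolding lorentzian_def by blast
qed

text \<open>The determinant does not vanish while \<open>A\<close> is deformed, first by adding multiples of
  \<open>\<nu> \<nu>\<^sup>T\<close> until the form is positive on \<open>\<nu>\<close>, then along the segment to a diagonal matrix.\<close>

lemma lorentzian_det_sign_axis:
  fixes A :: "real^'n::finite^'n"
  assumes A: "lorentzian A (axis k 1)"
  shows "0 < (- 1) ^ (CARD('n) - 1) * det A"
proof -
  define e where "e = (axis k 1 :: real^'n)"
  \<comment> \<open>large enough to make the form positive on \<open>e\<close>\<close>
  define c where "c = \<bar>e \<bullet> (A *v e)\<bar> + 1"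
  define B where "B = A + c *\<^sub>R (\<chi> i j. e $ i * e $ j)"
  have c: "0 \<le> c" by (simp add: c_def)
  have B: "lorentzian B e" "v \<bullet> (B *v v) = v \<bullet> (A *v v) + c * (e \<bullet> v)^2" for v
    unfolding B_def using lorentzian_add_rank_one[OF A c] by (simp_all add: e_def)
  obtain w where w: "0 < w \<bullet> (A *v w)" using A by (auto simp: lorentzian_def)
  have "0 < w \<bullet> (B *v w)" using w c by (simp add: B(2) add_pos_nonneg)
  with lorentzian_det_same_sign[OF A B(1)[unfolded e_def] w] have 1: "0 < det A * det B" by simp
  have "e \<bullet> (B *v e) = e \<bullet> (A *v e) + c" by (simp add: B(2) e_def)
  then have "0 < e \<bullet> (B *v e)" by (simp add: c_def abs_if)
  moreover have "0 < e \<bullet> (reflection_matrix k *v e)" by (simp add: reflection_matrix_quadratic e_def)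
  ultimately have 2: "0 < det B * det (reflection_matrix k)"
    using lorentzian_det_same_sign[OF B(1)[unfolded e_def] lorentzian_reflection_matrix] by blast
  from 1 2 show ?thesis
    unfolding det_reflection_matrix zero_less_mult_iff by auto
qed

text \<open>An orthogonal change of coordinates takes \<open>\<nu>\<close> to a coordinate axis and preserves the determinant.\<close>

lemma lorentzian_det_sign:
  fixes A :: "real^'n::finite^'n"
  assumes A: "lorentzian A \<nu>" and "\<nu> \<noteq> 0"
  shows "0 < (- 1) ^ (CARD('n) - 1) * det A"
proof -
  obtain k :: 'n where True by blast
  have "norm (axis k 1 :: real^'n) = norm (sgn \<nu>)" using assms(2) by (simp add: norm_sgn)
  then obtain f where f: "orthogonal_transformation f" "f (axis k 1 :: real^'n) = sgn \<nu>"
    using orthogonal_transformation_exists by metis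
  define Q where "Q = matrix f"
  have Q: "Q *v v = f v" for v
    using f(1) by (simp add: Q_def matrix_works orthogonal_transformation_linear linear_matrix_vector_mul_eq)
  have Qo: "orthogonal_matrix Q" using f(1) by (simp add: Q_def orthogonal_transformation_matrix)
  define A' where "A' = transpose Q ** A ** Q"
  have q: "v \<bullet> (A' *v w) = (Q *v v) \<bullet> (A *v (Q *v w))" for v w
    by (simp add: A'_def flip: matrix_vector_mul_assoc)
      (metis dot_lmul_matrix transpose_matrix_vector inner_commute)
  have sym: "transpose A = A" and neg: "\<And>v. v \<noteq> 0 \<Longrightarrow> v \<bullet> \<nu> = 0 \<Longrightarrow> v \<bullet> (A *v v) < 0"
    using A by (auto simp: lorentzian_def)
  have "transpose A' = A'" by (simp add: A'_def matrix_transpose_mul sym matrix_mul_assoc)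
  moreover obtain w where w: "0 < w \<bullet> (A *v w)" using A by (auto simp: lorentzian_def)
  have "Q *v (transpose Q *v w) = w"
    using Qo by (simp add: matrix_vector_mul_assoc orthogonal_matrix_def del: transpose_matrix_vector)
  then have "0 < (transpose Q *v w) \<bullet> (A' *v (transpose Q *v w))" using w by (simp add: q)
  moreover have "v \<bullet> (A' *v v) < 0" if v: "v \<noteq> 0" "v \<bullet> axis k 1 = 0" for v
  proof -
    have "f v \<bullet> sgn \<nu> = 0"
      using v(2) f by (simp add: orthogonal_transformation_def flip: f(2))
    then have "f v \<bullet> \<nu> = 0" using assms(2) by (simp add: sgn_div_norm)
    moreover have "f v \<noteq> 0"
      using v(1) orthogonal_transformation_norm[OF f(1), of v] by auto
    ultimately show ?thesis using neg by (simp add: q Q)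
  qed
  ultimately have "lorentzian A' (axis k 1)" unfolding lorentzian_def by blast
  from lorentzian_det_sign_axis[OF this] have "0 < (- 1) ^ (CARD('n) - 1) * det A'" .
  moreover have "det A' = det A" 
    using det_orthogonal_matrix[OF Qo] by (auto simp: A'_def det_mul)
  ultimately show ?thesis by simp
qed

section \<open>The Gauss map of a strictly convex body\<close>

lemma decay_along_line:
  assumes "(u has_derivative (\<lambda>h. gradient u x \<bullet> h)) (at x)" "gradient u x \<bullet> w < 0"
  shows "\<forall>\<^sub>F s in at_right 0. u (x + s *\<^sub>R w) < u x"
proof -
  have "((\<lambda>s. u (x + s *\<^sub>R w)) has_real_derivative gradient u x \<bullet> w) (at 0)"
    by (rule line_derivative) (use assms(1) in simp)
  from DERIV_neg_dec_right[OF this assms(2)]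
  obtain d where "d > 0" "\<And>h. 0 < h \<Longrightarrow> h < d \<Longrightarrow> u (x + h *\<^sub>R w) < u x" by auto
  then show ?thesis by (intro eventually_at_rightI[of 0 d]) simp_all
qed

lemma eventually_line_in_open:
  fixes p w :: "'a::real_normed_vector"
  assumes "open U" "p \<in> U"
  shows "\<forall>\<^sub>F s in at_right 0. p + s *\<^sub>R w \<in> U"
proof (rule topological_tendstoD[OF _ assms])
  have "((\<lambda>s. p + s *\<^sub>R w) \<longlongrightarrow> p + 0 *\<^sub>R w) (at_right 0)" by (intro tendsto_intros)
  then show "((\<lambda>s. p + s *\<^sub>R w) \<longlongrightarrow> p) (at_right 0)" by simp
qed

lemma strictly_convex_boundary_chart:
  assumes "smooth_strictly_convex_boundary K" "p \<in> frontier K"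
  obtains U \<phi> where "open U" "p \<in> U" "Ck_on (Suc (Suc 0)) \<phi> U" "gradient \<phi> p \<noteq> 0" "\<phi> p = 0"
    "\<And>x. x \<in> U \<Longrightarrow> x \<in> frontier K \<longleftrightarrow> \<phi> x = 0" "\<And>x. x \<in> U \<Longrightarrow> x \<in> interior K \<longleftrightarrow> \<phi> x < 0"
    "\<And>v. v \<noteq> 0 \<Longrightarrow> v \<bullet> gradient \<phi> p = 0 \<Longrightarrow> 0 < second_fundamental_form \<phi> p v v"
proof -
  have "\<forall>p\<in>frontier K. \<exists>U \<phi>. open U \<and> p \<in> U \<and> smooth_on \<phi> U \<and>
      (\<forall>x\<in>U. gradient \<phi> x \<noteq> 0) \<and>
      (\<forall>x\<in>U. x \<in> frontier K \<longleftrightarrow> \<phi> x = 0) \<and>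
      (\<forall>x\<in>U. x \<in> interior K \<longleftrightarrow> \<phi> x < 0) \<and>
      (\<forall>v. v \<noteq> 0 \<and> v \<bullet> gradient \<phi> p = 0 \<longrightarrow> second_fundamental_form \<phi> p v v > 0)"
    using assms(1) unfolding smooth_strictly_convex_boundary_def by (elim conjE)
  from bspec[OF this assms(2)] show ?thesis
  proof (elim exE conjE)
    fix U \<phi>
    assume U: "open U" "p \<in> U" "smooth_on \<phi> U" "\<forall>x\<in>U. gradient \<phi> x \<noteq> 0"
      "\<forall>x\<in>U. x \<in> frontier K \<longleftrightarrow> \<phi> x = 0" "\<forall>x\<in>U. x \<in> interior K \<longleftrightarrow> \<phi> x < 0"
      "\<forall>v. v \<noteq> 0 \<and> v \<bullet> gradient \<phi> p = 0 \<longrightarrow> second_fundamental_form \<phi> p v v > 0"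
    have "Ck_on (Suc (Suc 0)) \<phi> U" using U(3) unfolding smooth_on_def by (rule spec)
    moreover have "\<phi> p = 0" "gradient \<phi> p \<noteq> 0" using U(2,4,5) assms(2) by blast+
    ultimately show thesis using U by (intro that[of U \<phi>]) simp_all
  qed
qed

text \<open>The boundary is smooth at \<open>p\<close>, so the directions that point into the body fill an open half space, and there
  is only one unit vector whose product with all of them is nonnegative.\<close>

lemma inward_cone_normal:
  fixes K :: "(real^'n::finite) set"
  assumes "smooth_strictly_convex_boundary K" "p \<in> frontier K"
  shows "\<exists>\<nu>. \<forall>M. M \<noteq> 0 \<longrightarrow>
    (\<forall>w. (\<forall>\<^sub>F s in at_right 0. p + s *\<^sub>R w \<in> interior K) \<longrightarrow> 0 \<le> M \<bullet> w) \<longrightarrow> sgn M = \<nu>"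
proof -
  obtain U \<phi> where U: "open U" "p \<in> U" and \<phi>: "Ck_on (Suc (Suc 0)) \<phi> U" "gradient \<phi> p \<noteq> 0" "\<phi> p = 0"
    and fro: "\<And>x. x \<in> U \<Longrightarrow> x \<in> frontier K \<longleftrightarrow> \<phi> x = 0"
    and int: "\<And>x. x \<in> U \<Longrightarrow> x \<in> interior K \<longleftrightarrow> \<phi> x < 0"
    and II: "\<And>v. v \<noteq> 0 \<Longrightarrow> v \<bullet> gradient \<phi> p = 0 \<Longrightarrow> 0 < second_fundamental_form \<phi> p v v"
    by (rule strictly_convex_boundary_chart[OF assms]) (rule that)
  have "sgn M = sgn (- gradient \<phi> p)" if M: "M \<noteq> 0"
    "\<And>w. (\<forall>\<^sub>F s in at_right 0. p + s *\<^sub>R w \<in> interior K) \<Longrightarrow> 0 \<le> M \<bullet> w" for M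
  proof (rule sgn_eq_of_halfspace)
    show "- gradient \<phi> p \<noteq> 0" using \<phi>(2) by simp
    show "M \<noteq> 0" by fact
    fix w assume "0 < - gradient \<phi> p \<bullet> w"
    then have "gradient \<phi> p \<bullet> w < 0" by simp
    from decay_along_line[OF gradient_has_derivative_C1[OF \<phi>(1) U(2)] this]
    have "\<forall>\<^sub>F s in at_right 0. p + s *\<^sub>R w \<in> interior K"
      using eventually_line_in_open[OF U, of w] by eventually_elim (use int \<phi>(3) in simp)
    then show "0 \<le> M \<bullet> w" by (rule M(2))
  qed
  then show ?thesis by blast
qed

lemma minimizer_in_frontier:
  fixes K :: "'a::euclidean_space set"
  assumes "\<nu> \<noteq> 0" "y \<in> K" "\<And>z. z \<in> K \<Longrightarrow> \<nu> \<bullet> y \<le> \<nu> \<bullet> z"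
  shows "y \<in> frontier K"
proof -
  have "y \<notin> interior K"
  proof
    assume "y \<in> interior K"
    with eventually_line_in_open[OF open_interior this, of "- \<nu>"]
    have "\<forall>\<^sub>F s in at_right 0. y + s *\<^sub>R (- \<nu>) \<in> interior K \<and> 0 < s"
      by (simp add: eventually_conj eventually_at_right_less)
    then obtain s where s: "y + s *\<^sub>R (- \<nu>) \<in> interior K" "0 < s"
      using eventually_happens[of _ "at_right (0::real)"] by force
    then have "\<nu> \<bullet> y \<le> \<nu> \<bullet> (y + s *\<^sub>R (- \<nu>))"
      using interior_subset by (intro assms(3)) blast
    then have "s * (\<nu> \<bullet> \<nu>) \<le> 0" by (simp add: inner_diff_right)
    moreover have "0 < s * (\<nu> \<bullet> \<nu>)" using s(2) assms(1) by simp
    ultimately show False by linarith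
  qed
  then show ?thesis using assms(2) closure_subset by (auto simp: frontier_def)
qed

text \<open>Between two minimizers, a whole segment would lie in the boundary, and the boundary would be flat
  in its direction.\<close>

lemma unique_minimizer:
  fixes K :: "(real^'n::finite) set"
  assumes K: "smooth_strictly_convex_boundary K" and \<nu>: "\<nu> \<noteq> 0"
    and p: "p \<in> K" "\<And>z. z \<in> K \<Longrightarrow> \<nu> \<bullet> p \<le> \<nu> \<bullet> z"
    and q: "q \<in> K" "\<And>z. z \<in> K \<Longrightarrow> \<nu> \<bullet> q \<le> \<nu> \<bullet> z"
  shows "p = q"
proof (rule ccontr)
  assume "p \<noteq> q"
  define v where "v = q - p"
  have v: "v \<noteq> 0" using \<open>p \<noteq> q\<close> by (simp add: v_def)
  have "convex K" using K by (simp add: smooth_strictly_convex_boundary_def)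
  have pq: "\<nu> \<bullet> p = \<nu> \<bullet> q" using p(2)[OF q(1)] q(2)[OF p(1)] by simp
  have fr: "p + s *\<^sub>R v \<in> frontier K" if "0 \<le> s" "s \<le> 1" for s
  proof (rule minimizer_in_frontier[OF \<nu>])
    have "p + s *\<^sub>R v = (1 - s) *\<^sub>R p + s *\<^sub>R q" by (simp add: v_def algebra_simps)
    then show "p + s *\<^sub>R v \<in> K" using convexD_alt[OF \<open>convex K\<close> p(1) q(1) that] by simp
    have "\<nu> \<bullet> (p + s *\<^sub>R v) = \<nu> \<bullet> p" using pq by (simp add: v_def inner_add_right inner_diff_right)
    then show "\<nu> \<bullet> (p + s *\<^sub>R v) \<le> \<nu> \<bullet> z" if "z \<in> K" for z using p(2)[OF that] by simp
  qed
  have "p \<in> frontier K" using fr[of 0] by simp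
  then obtain U \<phi> where U: "open U" "p \<in> U" and \<phi>: "Ck_on (Suc (Suc 0)) \<phi> U" "gradient \<phi> p \<noteq> 0" "\<phi> p = 0"
    and fro: "\<And>x. x \<in> U \<Longrightarrow> x \<in> frontier K \<longleftrightarrow> \<phi> x = 0"
    and int: "\<And>x. x \<in> U \<Longrightarrow> x \<in> interior K \<longleftrightarrow> \<phi> x < 0"
    and II: "\<And>v. v \<noteq> 0 \<Longrightarrow> v \<bullet> gradient \<phi> p = 0 \<Longrightarrow> 0 < second_fundamental_form \<phi> p v v"
    by (rule strictly_convex_boundary_chart[OF K]) (rule that)
  have "\<forall>\<^sub>F s in at_right 0. s < (1::real)" by (rule eventually_at_rightI[of 0 1]) simp_all
  then have zero: "\<forall>\<^sub>F s in at_right 0. \<phi> (p + s *\<^sub>R v) = 0"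
    using eventually_line_in_open[OF U, of v] eventually_at_right_less[of "0::real"]
  proof eventually_elim
    case (elim s)
    then show ?case using fr[of s] fro[of "p + s *\<^sub>R v"] by simp
  qed
  note d\<phi> = gradient_has_derivative_C1[OF \<phi>(1) U(2)]
  have "gradient \<phi> p \<bullet> v = 0"
  proof (rule ccontr)
    assume "gradient \<phi> p \<bullet> v \<noteq> 0"
    then consider "0 < gradient \<phi> p \<bullet> v" | "gradient \<phi> p \<bullet> v < 0" by linarith
    then show False
    proof cases
      case 1
      from growth_along_line[OF d\<phi> this] zero
      have "\<forall>\<^sub>F s in at_right (0::real). False" by eventually_elim (simp add: \<phi>(3))
      then show False by simp
    next
      case 2
      from decay_along_line[OF d\<phi> this] zero
      have "\<forall>\<^sub>F s in at_right (0::real). False" by eventually_elim (simp add: \<phi>(3))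
      then show False by simp
    qed
  qed
  then have g: "gradient \<phi> p \<bullet> v = 0" "v \<bullet> gradient \<phi> p = 0" by (simp_all add: inner_commute)
  have "0 < v \<bullet> (hessian \<phi> p *v v)"
    using II[OF v g(2)] second_fundamental_form_tangent[OF U \<phi>(1,2) g(2)] \<phi>(2)
    by (simp add: zero_less_divide_iff)
  then have "0 < v \<bullet> (hessian \<phi> p *v v) + 2 * (gradient \<phi> p \<bullet> 0)" by simp
  from growth_along_parabola[OF U \<phi>(1) g(1) this] zero
  have "\<forall>\<^sub>F s in at_right (0::real). False" by eventually_elim (simp add: \<phi>(3))
  then show False by simp
qed

text \<open>The boundary point with normal \<open>\<nu>\<close> is the point at which \<open>\<nu> \<bullet> x\<close> is minimal on \<open>K\<close>. The field
  \<open>N\<close> enters only through the half space of inward directions, so that it may be a gradient which is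
  known on one side of the boundary only.\<close>

lemma gauss_map_bijective:
  fixes K :: "(real^'n::finite) set"
  assumes K: "smooth_strictly_convex_boundary K" "compact K"
    and N: "\<And>p. p \<in> frontier K \<Longrightarrow> N p \<noteq> 0"
    and inward: "\<And>p w. p \<in> frontier K \<Longrightarrow>
      (\<forall>\<^sub>F s in at_right 0. p + s *\<^sub>R w \<in> interior K) \<Longrightarrow> 0 \<le> N p \<bullet> w"
    and \<nu>: "norm \<nu> = 1"
  shows "\<exists>!p. p \<in> frontier K \<and> sgn (N p) = \<nu>"
proof -
  have nz: "\<nu> \<noteq> 0" and sgn\<nu>: "sgn \<nu> = \<nu>" using \<nu> by (auto simp: sgn_div_norm)
  have conv: "convex K" and ne: "interior K \<noteq> {}"
    using K(1) by (simp_all add: smooth_strictly_convex_boundary_def)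
  have closed: "closed K" using K(2) by (rule compact_imp_closed)
  have frK: "frontier K \<subseteq> K" using closed by (simp add: frontier_subset_eq)
  have minimal: "\<nu> \<bullet> p \<le> \<nu> \<bullet> y" if p: "p \<in> frontier K" "sgn (N p) = \<nu>" and y: "y \<in> K" for p y
  proof -
    have "\<nu> \<bullet> p \<le> \<nu> \<bullet> y" if y: "y \<in> interior K" for y
    proof -
      have "open_segment y p \<subseteq> interior K"
        using in_interior_closure_convex_segment[OF conv y] p(1) by (simp add: frontier_def)
      moreover have "p + s *\<^sub>R (y - p) \<in> open_segment y p" if "0 < s" "s < 1" for s
      proof -
        have "y \<noteq> p" using y p(1) by (auto simp: frontier_def)
        moreover have "p + s *\<^sub>R (y - p) = (1 - (1 - s)) *\<^sub>R y + (1 - s) *\<^sub>R p"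
          by (simp add: algebra_simps)
        ultimately show ?thesis unfolding in_segment(2) using that by (intro conjI exI[of _ "1 - s"]) simp_all
      qed
      ultimately have "\<forall>\<^sub>F s in at_right 0. p + s *\<^sub>R (y - p) \<in> interior K"
        by (intro eventually_at_rightI[of 0 1]) auto
      then have "0 \<le> N p \<bullet> (y - p)" by (rule inward[OF p(1)])
      then have "0 \<le> sgn (N p) \<bullet> (y - p)" by (simp add: sgn_div_norm)
      then show ?thesis by (simp add: p(2) inner_diff_right)
    qed
    then have "interior K \<subseteq> {y. \<nu> \<bullet> p \<le> \<nu> \<bullet> y}" by blast
    moreover have "closed {y. \<nu> \<bullet> p \<le> \<nu> \<bullet> y}" using closed_halfspace_ge[of "\<nu> \<bullet> p" \<nu>] by simp
    ultimately have "closure (interior K) \<subseteq> {y. \<nu> \<bullet> p \<le> \<nu> \<bullet> y}" by (rule closure_minimal)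
    then show ?thesis using y closure_subset[of K] convex_closure_interior[OF conv ne] by auto
  qed
  have normal: "sgn (N p) = \<nu>" if p: "p \<in> frontier K" and m: "\<And>y. y \<in> K \<Longrightarrow> \<nu> \<bullet> p \<le> \<nu> \<bullet> y" for p
  proof -
    have "0 \<le> \<nu> \<bullet> w" if "\<forall>\<^sub>F s in at_right 0. p + s *\<^sub>R w \<in> interior K" for w
    proof -
      from that have "\<forall>\<^sub>F s in at_right 0. p + s *\<^sub>R w \<in> interior K \<and> 0 < s"
        by (simp add: eventually_conj eventually_at_right_less)
      then obtain s where s: "p + s *\<^sub>R w \<in> interior K" "0 < s"
        using eventually_happens[of _ "at_right (0::real)"] by force
      then have "\<nu> \<bullet> p \<le> \<nu> \<bullet> (p + s *\<^sub>R w)" using interior_subset by (intro m) blast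
      then show ?thesis using s(2) by (simp add: inner_add_right zero_le_mult_iff)
    qed
    then have "sgn \<nu> = sgn (N p)"
      using inward_cone_normal[OF K(1) p] N[OF p] inward[OF p] nz by metis
    then show ?thesis using sgn\<nu> by simp
  qed
  have "K \<noteq> {}" using ne interior_subset by blast
  moreover have "continuous_on K (\<lambda>y. \<nu> \<bullet> y)" by (intro continuous_intros)
  ultimately obtain p where p: "p \<in> K" "\<And>y. y \<in> K \<Longrightarrow> \<nu> \<bullet> p \<le> \<nu> \<bullet> y"
    using continuous_attains_inf[OF K(2)] by blast
  show ?thesis
  proof
    have "p \<in> frontier K" using p by (rule minimizer_in_frontier[OF nz])
    then show "p \<in> frontier K \<and> sgn (N p) = \<nu>" using normal p(2) by blast
    show "q = p" if "q \<in> frontier K \<and> sgn (N q) = \<nu>" for q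
      using that frK minimal p by (intro unique_minimizer[OF K(1) nz]) blast+
  qed
qed

section \<open>Functions that are differentiable up to the boundary\<close>

text \<open>At a boundary point the derivative is only known as a limit from inside. The mean value theorem still gives
  the sign of increments along segments that stay inside.\<close>

lemma growth_from_boundary:
  fixes f :: "'a::euclidean_space \<Rightarrow> real" and G :: "'a \<Rightarrow> 'a"
  assumes p: "p \<in> closure \<Omega>"
    and f: "continuous_on (closure \<Omega>) f" and G: "continuous_on (closure \<Omega>) G"
    and der: "\<And>x. x \<in> \<Omega> \<Longrightarrow> (f has_derivative (\<lambda>h. G x \<bullet> h)) (at x)"
    and path: "\<forall>\<^sub>F s in at_right 0. p + s *\<^sub>R w \<in> \<Omega>" and pos: "0 < G p \<bullet> w"
  shows "\<forall>\<^sub>F s in at_right 0. f p < f (p + s *\<^sub>R w)"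
proof -
  obtain d where d: "0 < d" "\<And>s. 0 < s \<Longrightarrow> s < d \<Longrightarrow> p + s *\<^sub>R w \<in> \<Omega>"
    using path unfolding eventually_at_right_field by blast
  define I where "I = {0..d / 2}"
  have path_closure: "p + s *\<^sub>R w \<in> closure \<Omega>" if "s \<in> I" for s
  proof (cases "s = 0")
    case False
    then have "p + s *\<^sub>R w \<in> \<Omega>" using that d(1) by (intro d(2)) (auto simp: I_def)
    then show ?thesis using closure_subset by blast
  qed (simp add: p)
  have line: "continuous_on I (\<lambda>s. p + s *\<^sub>R w)" by (intro continuous_intros)
  have contf: "continuous_on I (\<lambda>s. f (p + s *\<^sub>R w))"
    by (rule continuous_on_compose2[OF f line]) (use path_closure in blast)
  have "continuous_on I (\<lambda>s. G (p + s *\<^sub>R w))"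
    by (rule continuous_on_compose2[OF G line]) (use path_closure in blast)
  then have contG: "continuous_on I (\<lambda>s. G (p + s *\<^sub>R w) \<bullet> w)" by (intro continuous_intros)
  have "0 \<in> I" using d(1) by (simp add: I_def)
  then obtain e where e: "0 < e"
    "\<And>s. s \<in> I \<Longrightarrow> dist s 0 < e \<Longrightarrow> dist (G (p + s *\<^sub>R w) \<bullet> w) (G (p + 0 *\<^sub>R w) \<bullet> w) < G p \<bullet> w"
    using contG pos unfolding continuous_on_iff by meson
  show ?thesis
  proof (rule eventually_at_rightI)
    show "0 < min (d / 2) e" using d(1) e(1) by simp
    fix s assume s: "s \<in> {0<..<min (d / 2) e}"
    have "f (p + 0 *\<^sub>R w) < f (p + s *\<^sub>R w)"
    proof (rule DERIV_pos_imp_increasing_open[where f = "\<lambda>s. f (p + s *\<^sub>R w)" and a = 0 and b = s])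
      show "0 < s" using s by simp
      show "continuous_on {0..s} (\<lambda>s. f (p + s *\<^sub>R w))"
        using s by (intro continuous_on_subset[OF contf]) (auto simp: I_def)
      fix t assume t: "0 < t" "t < s"
      have "p + t *\<^sub>R w \<in> \<Omega>" using t s d(1) by (intro d(2)) auto
      then have "((\<lambda>t. f (p + t *\<^sub>R w)) has_real_derivative G (p + t *\<^sub>R w) \<bullet> w) (at t)"
        by (intro line_derivative der)
      moreover have "0 < G (p + t *\<^sub>R w) \<bullet> w"
      proof -
        have "t \<in> I" "dist t 0 < e" using t s by (auto simp: I_def)
        from e(2)[OF this] show ?thesis by (simp add: dist_real_def)
      qed
      ultimately show "\<exists>y. ((\<lambda>t. f (p + t *\<^sub>R w)) has_real_derivative y) (at t) \<and> 0 < y" by blast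
    qed
    then show "f p < f (p + s *\<^sub>R w)" by simp
  qed
qed

lemma decay_from_boundary:
  fixes f :: "'a::euclidean_space \<Rightarrow> real" and G :: "'a \<Rightarrow> 'a"
  assumes p: "p \<in> closure \<Omega>"
    and f: "continuous_on (closure \<Omega>) f" and G: "continuous_on (closure \<Omega>) G"
    and der: "\<And>x. x \<in> \<Omega> \<Longrightarrow> (f has_derivative (\<lambda>h. G x \<bullet> h)) (at x)"
    and path: "\<forall>\<^sub>F s in at_right 0. p + s *\<^sub>R w \<in> \<Omega>" and neg: "G p \<bullet> w < 0"
  shows "\<forall>\<^sub>F s in at_right 0. f (p + s *\<^sub>R w) < f p"
proof -
  have "\<forall>\<^sub>F s in at_right 0. - f p < - f (p + s *\<^sub>R w)"
  proof (rule growth_from_boundary[where f = "\<lambda>x. - f x" and G = "\<lambda>x. - G x", OF p _ _ _ path])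
    show "continuous_on (closure \<Omega>) (\<lambda>x. - f x)" using f by (intro continuous_intros)
    show "continuous_on (closure \<Omega>) (\<lambda>x. - G x)" using G by (intro continuous_intros)
    show "((\<lambda>x. - f x) has_derivative (\<lambda>h. - G x \<bullet> h)) (at x)" if "x \<in> \<Omega>" for x
      using has_derivative_minus[OF der[OF that]] by simp
  qed (use neg in simp)
  then show ?thesis by simp
qed

lemma gradient_closure_continuous:
  assumes u: "Ck_on_closure (Suc k) u \<Omega>" and "open \<Omega>"
  shows "continuous_on (closure \<Omega>) (gradient_closure \<Omega> u)"
proof -
  have "partials_extend (Suc k) u \<Omega>" using u by (simp only: Ck_on_closure_def)
  then have pe: "\<forall>b\<in>Basis. partials_extend k (\<lambda>x. frechet_derivative u (at x) b) \<Omega>"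
    unfolding partials_extend.simps by (elim conjE)
  have "\<exists>g. continuous_on (closure \<Omega>) g \<and> (\<forall>x\<in>\<Omega>. g x = partial i u x)" for i
  proof -
    have "partials_extend k (\<lambda>x. frechet_derivative u (at x) (axis i 1)) \<Omega>"
      by (rule bspec[OF pe]) simp
    then show ?thesis unfolding partial_def by (cases k) (simp_all only: partials_extend.simps)
  qed
  then obtain g where g: "\<And>i. continuous_on (closure \<Omega>) (g i)" "\<And>i x. x \<in> \<Omega> \<Longrightarrow> g i x = partial i u x"
    by metis
  define G where "G x = (\<chi> i. g i x)" for x
  have G: "continuous_on (closure \<Omega>) G" unfolding G_def by (intro continuous_on_vec_lambda g(1))
  have G_eq: "G x = gradient u x" if "x \<in> \<Omega>" for x
    using that by (simp add: G_def gradient_def g(2))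
  have "gradient_closure \<Omega> u x = G x" if x: "x \<in> closure \<Omega>" for x
  proof (cases "x \<in> \<Omega>")
    case False
    then have "x islimpt \<Omega>" using x by (simp add: closure_def)
    then have nontriv: "at x within \<Omega> \<noteq> bot" by (simp add: trivial_limit_within)
    have "(G \<longlongrightarrow> G x) (at x within \<Omega>)"
      using G x closure_subset[of \<Omega>] unfolding continuous_on_def
      by (meson tendsto_within_subset)
    then have "(gradient u \<longlongrightarrow> G x) (at x within \<Omega>)"
      by (rule Lim_transform_eventually) (simp add: eventually_at_filter G_eq)
    then show ?thesis using False tendsto_Lim[OF nontriv] by (simp add: gradient_closure_def)
  qed (simp add: gradient_closure_def G_eq)
  then show ?thesis using G by (simp cong: continuous_on_cong)
qed

section \<open>Convex rings\<close>

text \<open>The hypotheses on the boundary value problem, with \<open>Ck_on\<close> at successors of zero so that its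
  recursion equations apply.\<close>

locale convex_ring_solution =
  fixes \<Omega>0 \<Omega>1 \<Omega> \<U> :: "(real^'n::finite) set"
    and a :: "real^'n \<Rightarrow> real^'n^'n"
    and u :: "real^'n \<Rightarrow> real"
  assumes dimension: "CARD('n) \<ge> 2"
    and outer: "smooth_strictly_convex_domain \<Omega>0"
    and inner: "smooth_strictly_convex_domain \<Omega>1"
    and nested: "closure \<Omega>1 \<subseteq> \<Omega>0"
    and ring: "\<Omega> = \<Omega>0 - closure \<Omega>1"
    and a_pos: "\<And>q. q \<in> \<U> \<Longrightarrow> positive_definite (a q)"
    and u_C3: "Ck_on (Suc (Suc (Suc 0))) u \<Omega>"
    and u_closure: "Ck_on_closure (Suc (Suc 0)) u \<Omega>"
    and gradient_range: "gradient_closure \<Omega> u ` closure \<Omega> \<subseteq> \<U>"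
    and equation: "\<And>x. x \<in> \<Omega> \<Longrightarrow>
      (\<Sum>i\<in>UNIV. \<Sum>j\<in>UNIV. a (gradient u x) $ i $ j * hessian u x $ i $ j) = 0"
    and u_outer: "\<And>x. x \<in> frontier \<Omega>0 \<Longrightarrow> u x = 0"
    and u_inner: "\<And>x. x \<in> frontier \<Omega>1 \<Longrightarrow> u x = 1"
    and noncritical: "\<And>x. x \<in> closure \<Omega> \<Longrightarrow> gradient_closure \<Omega> u x \<noteq> 0"
    and level_bodies: "\<And>t. 0 \<le> t \<Longrightarrow> t \<le> 1 \<Longrightarrow>
      smooth_strictly_convex_boundary (superlevel_body \<Omega> \<Omega>1 u t)"
begin

abbreviation Du :: "real^'n \<Rightarrow> real^'n" where "Du \<equiv> gradient_closure \<Omega> u"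

abbreviation K :: "real \<Rightarrow> (real^'n) set" where "K \<equiv> superlevel_body \<Omega> \<Omega>1 u"

lemma open_outer: "open \<Omega>0" and open_inner: "open \<Omega>1"
  and convex_outer: "convex \<Omega>0" and convex_inner: "convex \<Omega>1" and bounded_outer: "bounded \<Omega>0"
  using outer inner by (auto simp: smooth_strictly_convex_domain_def)

lemma open_ring: "open \<Omega>"
  unfolding ring using open_outer by (intro open_Diff) simp_all

lemma interior_closure_domain: "interior (closure \<Omega>0) = \<Omega>0" "interior (closure \<Omega>1) = \<Omega>1"
  using convex_interior_closure[OF convex_outer] convex_interior_closure[OF convex_inner]
    open_outer open_inner by (simp_all add: interior_open)

lemma frontier_domain: "frontier \<Omega>0 = closure \<Omega>0 - \<Omega>0" "frontier \<Omega>1 = closure \<Omega>1 - \<Omega>1"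
  using open_outer open_inner by (simp_all add: frontier_def interior_open)

lemma closure_ring: "closure \<Omega> = \<Omega> \<union> frontier \<Omega>0 \<union> frontier \<Omega>1"
proof
  have "closure \<Omega> \<subseteq> closure \<Omega>0" by (intro closure_mono) (simp add: ring Diff_subset)
  moreover have "closure \<Omega> \<subseteq> - \<Omega>1"
    using open_inner closure_subset[of \<Omega>1] by (intro closure_minimal) (auto simp: ring)
  ultimately show "closure \<Omega> \<subseteq> \<Omega> \<union> frontier \<Omega>0 \<union> frontier \<Omega>1"
    unfolding frontier_domain ring by blast
  have "\<Omega>0 \<subseteq> \<Omega> \<union> closure \<Omega>1" by (auto simp: ring)
  then have "closure \<Omega>0 \<subseteq> closure \<Omega> \<union> closure \<Omega>1"
    using closure_mono[of \<Omega>0 "\<Omega> \<union> closure \<Omega>1"] by simp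
  then have "frontier \<Omega>0 \<subseteq> closure \<Omega>" using nested unfolding frontier_domain by blast
  moreover have "frontier \<Omega>1 \<subseteq> closure \<Omega>"
  proof -
    have "frontier \<Omega>1 \<subseteq> \<Omega>0 \<inter> closure (- closure \<Omega>1)"
      using nested by (auto simp: closure_complement interior_closure_domain frontier_domain)
    also have "\<dots> \<subseteq> closure (\<Omega>0 \<inter> - closure \<Omega>1)" by (rule open_Int_closure_subset[OF open_outer])
    also have "\<Omega>0 \<inter> - closure \<Omega>1 = \<Omega>" by (auto simp: ring)
    finally show ?thesis .
  qed
  ultimately show "\<Omega> \<union> frontier \<Omega>0 \<union> frontier \<Omega>1 \<subseteq> closure \<Omega>" using closure_subset by blast
qed

lemma compact_closure_ring: "compact (closure \<Omega>)"
  using bounded_subset[OF bounded_outer, of \<Omega>] by (simp add: ring Diff_subset compact_closure)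

lemma frontier_disjoint: "frontier \<Omega>0 \<inter> closure \<Omega>1 = {}" "frontier \<Omega>0 \<inter> \<Omega> = {}" "frontier \<Omega>1 \<inter> \<Omega> = {}"
  "\<Omega> \<inter> closure \<Omega>1 = {}"
  using nested unfolding frontier_domain ring by auto

lemma u_C2: "Ck_on (Suc (Suc 0)) u \<Omega>"
  using u_closure by (simp only: Ck_on_closure_def)

lemma u_continuous: "continuous_on (closure \<Omega>) u"
  using u_closure by (simp only: Ck_on_closure_def)

lemma Du_continuous: "continuous_on (closure \<Omega>) Du"
  by (rule gradient_closure_continuous[OF u_closure open_ring])

lemma Du_interior: "x \<in> \<Omega> \<Longrightarrow> Du x = gradient u x"
  by (simp add: gradient_closure_def)

lemma gradient_nonzero: "x \<in> \<Omega> \<Longrightarrow> gradient u x \<noteq> 0"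
  using noncritical[of x] closure_subset[of \<Omega>] by (auto simp: Du_interior)

lemma u_derivative: "x \<in> \<Omega> \<Longrightarrow> (u has_derivative (\<lambda>h. gradient u x \<bullet> h)) (at x)"
  by (rule gradient_has_derivative_C1[OF u_C2])

lemma u_derivative_Du: "x \<in> \<Omega> \<Longrightarrow> (u has_derivative (\<lambda>h. Du x \<bullet> h)) (at x)"
  using u_derivative by (simp add: Du_interior)

lemma no_local_extremum:
  assumes x: "x \<in> \<Omega>" and "open V" "x \<in> V"
  shows "\<exists>y\<in>\<Omega> \<inter> V. u x < u y" and "\<exists>y\<in>\<Omega> \<inter> V. u y < u x"
proof -
  let ?g = "gradient u x"
  have V: "open (\<Omega> \<inter> V)" "x \<in> \<Omega> \<inter> V" using assms open_ring by auto
  have gg: "0 < ?g \<bullet> ?g" using gradient_nonzero[OF x] by simp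
  have "\<forall>\<^sub>F s in at_right 0. u x < u (x + s *\<^sub>R ?g) \<and> x + s *\<^sub>R ?g \<in> \<Omega> \<inter> V"
    by (intro eventually_conj growth_along_line u_derivative eventually_line_in_open x gg V)
  then show "\<exists>y\<in>\<Omega> \<inter> V. u x < u y"
    using eventually_happens[of _ "at_right (0::real)"] by force
  have "\<forall>\<^sub>F s in at_right 0. u (x + s *\<^sub>R (- ?g)) < u x \<and> x + s *\<^sub>R (- ?g) \<in> \<Omega> \<inter> V"
    using gg by (intro eventually_conj decay_along_line u_derivative eventually_line_in_open x V) simp
  then show "\<exists>y\<in>\<Omega> \<inter> V. u y < u x"
    using eventually_happens[of _ "at_right (0::real)"] by force
qed

text \<open>The extrema of \<open>u\<close> on the compact closure are not in \<open>\<Omega>\<close>, hence they are boundary values.\<close>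

lemma u_bounds:
  assumes x: "x \<in> \<Omega>"
  shows "0 < u x" "u x < 1"
proof -
  have ne: "closure \<Omega> \<noteq> {}" using x closure_subset by blast
  have xc: "x \<in> closure \<Omega>" using x closure_subset by blast
  have bd: "u y = 0 \<or> u y = 1" if "y \<in> closure \<Omega>" "y \<notin> \<Omega>" for y
    using that u_outer u_inner unfolding closure_ring by blast
  obtain M where M: "M \<in> closure \<Omega>" "\<And>y. y \<in> closure \<Omega> \<Longrightarrow> u y \<le> u M"
    using continuous_attains_sup[OF compact_closure_ring ne u_continuous] by blast
  have "M \<notin> \<Omega>"
  proof
    assume "M \<in> \<Omega>"
    from no_local_extremum(1)[OF this open_UNIV] M(2) closure_subset show False by fastforce
  qed
  then have "u M \<le> 1" using bd[OF M(1)] by auto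
  obtain m where m: "m \<in> closure \<Omega>" "\<And>y. y \<in> closure \<Omega> \<Longrightarrow> u m \<le> u y"
    using continuous_attains_inf[OF compact_closure_ring ne u_continuous] by blast
  have "m \<notin> \<Omega>"
  proof
    assume "m \<in> \<Omega>"
    from no_local_extremum(2)[OF this open_UNIV] m(2) closure_subset show False by fastforce
  qed
  then have "0 \<le> u m" using bd[OF m(1)] by auto
  obtain y where "y \<in> \<Omega>" "u x < u y" using no_local_extremum(1)[OF x open_UNIV] by blast
  then show "u x < 1" using M(2)[of y] \<open>u M \<le> 1\<close> closure_subset[of \<Omega>] by fastforce
  obtain z where "z \<in> \<Omega>" "u z < u x" using no_local_extremum(2)[OF x open_UNIV] by blast
  then show "0 < u x" using m(2)[of z] \<open>0 \<le> u m\<close> closure_subset[of \<Omega>] by fastforce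
qed

lemma u_bounds_closure: "x \<in> closure \<Omega> \<Longrightarrow> 0 \<le> u x \<and> u x \<le> 1"
  using u_bounds u_outer u_inner unfolding closure_ring by fastforce

lemma frontier_levels:
  assumes "x \<in> closure \<Omega>"
  shows "x \<in> frontier \<Omega>0 \<longleftrightarrow> u x = 0" "x \<in> frontier \<Omega>1 \<longleftrightarrow> u x = 1"
  using assms u_bounds[of x] u_outer[of x] u_inner[of x] unfolding closure_ring by auto

section \<open>Level sets and the Hessian of the solution\<close>

lemma mem_level_body: "x \<in> K t \<longleftrightarrow> x \<in> closure \<Omega>1 \<or> (x \<in> closure \<Omega> \<and> t \<le> u x)"
  by (auto simp: superlevel_body_def)

lemma level_body_subset: "K t \<subseteq> closure \<Omega>0"
proof -
  have "closure \<Omega> \<subseteq> closure \<Omega>0" by (intro closure_mono) (simp add: ring Diff_subset)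
  moreover have "closure \<Omega>1 \<subseteq> closure \<Omega>0" using nested closure_subset by blast
  ultimately show ?thesis by (auto simp: mem_level_body)
qed

lemma level_body_one: "K 1 \<subseteq> closure \<Omega>1"
proof
  fix x assume x: "x \<in> K 1"
  show "x \<in> closure \<Omega>1"
  proof (rule ccontr)
    assume n: "x \<notin> closure \<Omega>1"
    then have xc: "x \<in> closure \<Omega>" and "u x = 1"
      using x u_bounds_closure[of x] by (auto simp: mem_level_body)
    then have "x \<in> frontier \<Omega>1" using frontier_levels(2)[OF xc] by simp
    then show False using n unfolding frontier_domain by blast
  qed
qed

lemma compact_level_body: "compact (K t)"
proof -
  have "closed {x \<in> closure \<Omega>. t \<le> u x}"
    using continuous_on_closed_Collect_le[OF continuous_on_const u_continuous closed_closure] .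
  then have "closed (K t)" unfolding superlevel_body_def by (intro closed_Un closed_closure)
  moreover have "bounded (K t)"
    using bounded_subset[OF bounded_closure[OF bounded_outer] level_body_subset] .
  ultimately show ?thesis by (simp add: compact_eq_bounded_closed)
qed

lemma interior_level_body_extreme: "interior (K t) \<subseteq> \<Omega>0" "interior (K 1) \<subseteq> \<Omega>1"
  using interior_mono[OF level_body_subset] interior_mono[OF level_body_one]
  by (auto simp: interior_closure_domain)

lemma above_level_interior:
  assumes x: "x \<in> closure \<Omega>" and t: "0 \<le> t" "t < u x"
  shows "x \<in> interior (K t)"
proof -
  have "x \<notin> frontier \<Omega>0" using t frontier_levels(1)[OF x] by simp
  moreover have "\<Omega> \<subseteq> \<Omega>0" "frontier \<Omega>1 \<subseteq> \<Omega>0"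
    using nested by (auto simp: ring frontier_domain)
  ultimately have x0: "x \<in> \<Omega>0" using x unfolding closure_ring by blast
  obtain d where d: "0 < d" "\<And>y. y \<in> closure \<Omega> \<Longrightarrow> dist y x < d \<Longrightarrow> dist (u y) (u x) < u x - t"
    using u_continuous x t unfolding continuous_on_iff by (metis diff_gt_0_iff_gt)
  have "ball x d \<inter> \<Omega>0 \<subseteq> K t"
  proof
    fix y assume y: "y \<in> ball x d \<inter> \<Omega>0"
    show "y \<in> K t"
    proof (cases "y \<in> closure \<Omega>1")
      case False
      then have yc: "y \<in> closure \<Omega>" using y closure_subset[of \<Omega>] by (auto simp: ring)
      have "dist (u y) (u x) < u x - t" using y by (intro d(2) yc) (simp add: dist_commute)
      then have "t \<le> u y" by (simp add: dist_real_def abs_less_iff)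
      then show ?thesis using yc by (simp add: mem_level_body)
    qed (simp add: mem_level_body)
  qed
  moreover have "x \<in> ball x d \<inter> \<Omega>0" using d(1) x0 by simp
  ultimately show ?thesis using open_outer by (intro interiorI[of "ball x d \<inter> \<Omega>0"]) auto
qed

text \<open>For \<open>t = 0\<close> and \<open>t = 1\<close> this gives the two boundary components, for the other \<open>t\<close> the level
  sets inside \<open>\<Omega>\<close>, so that all levels can be treated alike.\<close>

lemma frontier_level_body:
  assumes t: "0 \<le> t" "t \<le> 1"
  shows "frontier (K t) = {x \<in> closure \<Omega>. u x = t}"
proof (intro set_eqI iffI)
  fix x assume "x \<in> frontier (K t)"
  then have xK: "x \<in> K t" and xi: "x \<notin> interior (K t)"
    using compact_imp_closed[OF compact_level_body] by (simp_all add: frontier_def)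
  have "\<Omega>1 \<subseteq> interior (K t)"
    using closure_subset[of \<Omega>1] by (intro interior_maximal open_inner) (auto simp: mem_level_body)
  then have "x \<in> closure \<Omega>1 \<Longrightarrow> x \<in> frontier \<Omega>1" using xi unfolding frontier_domain by blast
  then have xc: "x \<in> closure \<Omega>" and "t \<le> u x"
    using xK u_inner[of x] t(2) unfolding mem_level_body closure_ring by auto
  moreover have "\<not> t < u x" using above_level_interior[OF xc t(1)] xi by blast
  ultimately show "x \<in> {x \<in> closure \<Omega>. u x = t}" by simp
next
  fix x assume "x \<in> {x \<in> closure \<Omega>. u x = t}"
  then have x: "x \<in> closure \<Omega>" "u x = t" by simp_all
  have "x \<notin> interior (K t)"
  proof
    assume i: "x \<in> interior (K t)"
    from x(1) consider "x \<in> \<Omega>" | "x \<in> frontier \<Omega>0" | "x \<in> frontier \<Omega>1" unfolding closure_ring by blast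
    then show False
    proof cases
      case 1
      obtain y where y: "y \<in> \<Omega>" "y \<in> interior (K t)" "u y < u x"
        using no_local_extremum(2)[OF 1 open_interior i] by blast
      then have "y \<in> K t" using interior_subset by blast
      then show False using y x(2) frontier_disjoint(4) by (auto simp: mem_level_body)
    next
      case 2
      then show False using i interior_level_body_extreme(1) unfolding frontier_domain by blast
    next
      case 3
      then have "t = 1" using x(2) u_inner by simp
      then show False using 3 i interior_level_body_extreme(2) unfolding frontier_domain by blast
    qed
  qed
  moreover have "x \<in> K t" using x by (simp add: mem_level_body)
  ultimately show "x \<in> frontier (K t)" using closure_subset by (auto simp: frontier_def)
qed

text \<open>The value of \<open>u\<close> in the body is at least \<open>t\<close>, which gives the sign of \<open>Du\<close> in inward directions. On the
  inner boundary the body lies outside of \<open>\<Omega>\<close>, so the opposite directions are used, along which \<open>u\<close>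
  falls below its boundary value.\<close>

lemma Du_inward:
  assumes t: "0 \<le> t" "t \<le> 1" and p: "p \<in> frontier (K t)"
    and w: "\<forall>\<^sub>F s in at_right 0. p + s *\<^sub>R w \<in> interior (K t)"
  shows "0 \<le> Du p \<bullet> w"
proof (rule ccontr)
  assume "\<not> 0 \<le> Du p \<bullet> w"
  then have neg: "Du p \<bullet> w < 0" by simp
  have pc: "p \<in> closure \<Omega>" and up: "u p = t" using p frontier_level_body[OF t] by auto
  have decay: "\<forall>\<^sub>F s in at_right 0. u (p + s *\<^sub>R z) < u p"
    if "\<forall>\<^sub>F s in at_right 0. p + s *\<^sub>R z \<in> \<Omega>" "Du p \<bullet> z < 0" for z
    by (rule decay_from_boundary[where G = Du, OF pc u_continuous Du_continuous _ that])
      (rule u_derivative_Du)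
  have growth: "\<forall>\<^sub>F s in at_right 0. u p < u (p + s *\<^sub>R z)"
    if "\<forall>\<^sub>F s in at_right 0. p + s *\<^sub>R z \<in> \<Omega>" "0 < Du p \<bullet> z" for z
    by (rule growth_from_boundary[where G = Du, OF pc u_continuous Du_continuous _ that])
      (rule u_derivative_Du)
  show False
  proof (cases "p \<in> frontier \<Omega>1")
    case False
    then have "p \<notin> closure \<Omega>1"
      using pc frontier_disjoint unfolding closure_ring by blast
    then have "\<forall>\<^sub>F s in at_right 0. p + s *\<^sub>R w \<in> - closure \<Omega>1"
      by (intro eventually_line_in_open) (auto simp: open_Compl)
    with w have "\<forall>\<^sub>F s in at_right 0. p + s *\<^sub>R w \<in> \<Omega> \<and> t \<le> u (p + s *\<^sub>R w)"
    proof eventually_elim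
      case (elim s)
      then have "p + s *\<^sub>R w \<in> \<Omega>" using interior_level_body_extreme(1) by (auto simp: ring)
      moreover have "p + s *\<^sub>R w \<in> K t" using elim(1) interior_subset by blast
      ultimately show ?case using frontier_disjoint(4) by (auto simp: mem_level_body)
    qed
    then have "\<forall>\<^sub>F s in at_right 0. p + s *\<^sub>R w \<in> \<Omega>" and ge: "\<forall>\<^sub>F s in at_right 0. t \<le> u (p + s *\<^sub>R w)"
      by (auto elim: eventually_mono)
    from decay[OF this(1) neg] ge
    have "\<forall>\<^sub>F s in at_right (0::real). False" by eventually_elim (simp add: up)
    then show False by simp
  next
    case True
    \<comment> \<open>The reflected segment leaves \<open>\<Omega>\<^sub>1\<close>, since \<open>p\<close> would otherwise be an interior point.\<close>
    then have t1: "t = 1" and p0: "p \<in> \<Omega>0" and p1: "p \<notin> \<Omega>1"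
      using up u_inner nested unfolding frontier_domain by auto
    have w0: "w \<noteq> 0" using neg by auto
    have "\<forall>\<^sub>F s in at_right 0. p + s *\<^sub>R (- w) \<in> \<Omega>0" by (rule eventually_line_in_open[OF open_outer p0])
    with w eventually_at_right_less[of "0::real"] have out: "\<forall>\<^sub>F s in at_right 0. p + s *\<^sub>R (- w) \<in> \<Omega>"
    proof eventually_elim
      case (elim s)
      have i: "p + s *\<^sub>R w \<in> interior \<Omega>1"
        using elim(1) interior_level_body_extreme(2) by (auto simp: t1 interior_open[OF open_inner])
      have "p + s *\<^sub>R (- w) \<notin> closure \<Omega>1"
      proof
        assume "p + s *\<^sub>R (- w) \<in> closure \<Omega>1"
        from in_interior_closure_convex_segment[OF convex_inner i this]
        have "open_segment (p + s *\<^sub>R w) (p + s *\<^sub>R (- w)) \<subseteq> \<Omega>1" using interior_subset by blast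
        moreover have "p \<in> open_segment (p + s *\<^sub>R w) (p + s *\<^sub>R (- w))"
        proof -
          have "p + s *\<^sub>R w \<noteq> p + s *\<^sub>R (- w)"
          proof
            assume "p + s *\<^sub>R w = p + s *\<^sub>R (- w)"
            then have "(2 * s) *\<^sub>R w = 0" by (simp add: scaleR_2 flip: scaleR_scaleR)
            then show False using elim(2) w0 by simp
          qed
          moreover have "p = (1 - 1 / 2) *\<^sub>R (p + s *\<^sub>R w) + (1 / 2) *\<^sub>R (p + s *\<^sub>R (- w))"
            by (simp add: vec_eq_iff field_simps)
          ultimately show ?thesis unfolding in_segment(2) by (intro conjI exI[of _ "1 / 2 :: real"]) simp_all
        qed
        ultimately show False using p1 by blast
      qed
      then show ?case using elim(3) by (simp add: ring)
    qed
    have "0 < Du p \<bullet> (- w)" using neg by simp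
    from growth[OF out this] out
    have "\<forall>\<^sub>F s in at_right (0::real). False"
    proof eventually_elim
      case (elim s)
      then show False using u_bounds(2)[OF elim(2)] up t1 by simp
    qed
    then show False by simp
  qed
qed

lemma gauss_level:
  assumes t: "0 \<le> t" "t \<le> 1" and \<nu>: "norm \<nu> = 1"
  shows "\<exists>!p. p \<in> closure \<Omega> \<and> u p = t \<and> sgn (Du p) = \<nu>"
proof -
  have "\<exists>!p. p \<in> frontier (K t) \<and> sgn (Du p) = \<nu>"
  proof (rule gauss_map_bijective[OF level_bodies[OF t] compact_level_body _ _ \<nu>])
    show "Du p \<noteq> 0" if "p \<in> frontier (K t)" for p
      using that noncritical unfolding frontier_level_body[OF t] by blast
    show "0 \<le> Du p \<bullet> w" if "p \<in> frontier (K t)" "\<forall>\<^sub>F s in at_right 0. p + s *\<^sub>R w \<in> interior (K t)" for p w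
      using Du_inward[OF t that] .
  qed
  then show ?thesis unfolding frontier_level_body[OF t] by simp
qed

lemma exists_tangent_vector: "\<exists>v::real^'n. v \<noteq> 0 \<and> v \<bullet> g = 0"
proof -
  have "\<exists>i j :: 'n. i \<noteq> j"
  proof (rule ccontr)
    assume "\<not> ?thesis"
    then have "(UNIV :: 'n set) \<subseteq> {undefined}" by blast
    from card_mono[OF _ this] show False using dimension by simp
  qed
  then obtain i j :: 'n where ij: "i \<noteq> j" by blast
  show ?thesis
  proof (cases "g $ i = 0")
    case True
    then have "axis i 1 \<bullet> g = 0" by (simp add: inner_axis')
    moreover have "axis i (1::real) \<noteq> 0" by (simp add: axis_eq_0_iff)
    ultimately show ?thesis by blast
  next
    case False
    define v where "v = g $ j *\<^sub>R axis i 1 - g $ i *\<^sub>R axis j (1::real)"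
    have "v $ j = - g $ i" using ij by (simp add: v_def axis_def)
    then have "v \<noteq> 0" using False by (metis neg_equal_0_iff_equal zero_index)
    moreover have "v \<bullet> g = 0" by (simp add: v_def inner_diff_left inner_axis' mult.commute)
    ultimately show ?thesis by blast
  qed
qed

lemma hessian_lorentzian:
  assumes x: "x \<in> \<Omega>"
  shows "lorentzian (hessian u x) (gradient u x)"
proof -
  have xc: "x \<in> closure \<Omega>" using x closure_subset by blast
  define t where "t = u x"
  have t: "0 \<le> t" "t \<le> 1" using u_bounds[OF x] by (simp_all add: t_def)
  have fr: "x \<in> frontier (K t)" unfolding frontier_level_body[OF t] using xc by (simp add: t_def)
  have sym: "transpose (hessian u x) = hessian u x"
    using hessian_symmetric[OF open_ring x u_C2] by (simp add: transpose_def vec_eq_iff)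
  obtain V \<phi> where V: "open V" "x \<in> V" and \<phi>: "Ck_on (Suc (Suc 0)) \<phi> V" "gradient \<phi> x \<noteq> 0" "\<phi> x = 0"
    and fro: "\<And>y. y \<in> V \<Longrightarrow> y \<in> frontier (K t) \<longleftrightarrow> \<phi> y = 0"
    and int: "\<And>y. y \<in> V \<Longrightarrow> y \<in> interior (K t) \<longleftrightarrow> \<phi> y < 0"
    and II: "\<And>v. v \<noteq> 0 \<Longrightarrow> v \<bullet> gradient \<phi> x = 0 \<Longrightarrow> 0 < second_fundamental_form \<phi> x v v"
    by (rule strictly_convex_boundary_chart[OF level_bodies[OF t] fr]) (rule that)
  have neg: "v \<bullet> (hessian u x *v v) < 0" if v: "v \<noteq> 0" "v \<bullet> gradient u x = 0" for v
  proof (rule hessian_negative_on_level_set[OF V open_ring x u_C2 \<phi>(1) gradient_nonzero[OF x] \<phi>(2,3) _ II v])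
    fix y assume y: "y \<in> V" "y \<in> \<Omega>" "u x < u y"
    have "y \<in> interior (K t)"
      using y closure_subset t(1) by (intro above_level_interior) (auto simp: t_def)
    then show "\<phi> y < 0" using int y(1) by blast
  qed
  have "hessian u x \<noteq> 0"
  proof
    assume 0: "hessian u x = 0"
    obtain v where "v \<noteq> 0" "v \<bullet> gradient u x = 0" using exists_tangent_vector by blast
    from neg[OF this] show False by (simp add: 0)
  qed
  moreover have "gradient u x \<in> \<U>" using gradient_range xc Du_interior[OF x] by force
  ultimately have "\<exists>w. 0 < w \<bullet> (hessian u x *v w)"
    using positive_direction_of_trace_zero[OF a_pos sym] equation[OF x] by blast
  then show ?thesis using sym neg by (auto simp: lorentzian_def)
qed

lemma hessian_det_sign: "x \<in> \<Omega> \<Longrightarrow> 0 < (- 1) ^ (CARD('n) - 1) * det (hessian u x)"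
  by (rule lorentzian_det_sign[OF hessian_lorentzian gradient_nonzero])

section \<open>The gradient map\<close>

text \<open>The point with coordinates \<open>(\<nu>, t)\<close>: the inverse of \<open>x \<mapsto> (Du / |Du|, u)\<close> on the closed ring.\<close>

definition level_point :: "real^'n \<Rightarrow> real \<Rightarrow> real^'n" where
  "level_point \<nu> t = (THE p. p \<in> closure \<Omega> \<and> u p = t \<and> sgn (Du p) = \<nu>)"

lemma level_point:
  assumes "norm \<nu> = 1" "0 \<le> t" "t \<le> 1"
  shows "level_point \<nu> t \<in> closure \<Omega>" "u (level_point \<nu> t) = t" "sgn (Du (level_point \<nu> t)) = \<nu>"
  using theI'[OF gauss_level[OF assms(2,3,1)]] by (simp_all add: level_point_def)

lemma level_point_unique:
  assumes "x \<in> closure \<Omega>"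
  shows "x = level_point (sgn (Du x)) (u x)"
proof -
  have \<nu>: "norm (sgn (Du x)) = 1" using noncritical[OF assms] by (simp add: norm_sgn)
  have t: "0 \<le> u x" "u x \<le> 1" using u_bounds_closure[OF assms] by simp_all
  show ?thesis
    using gauss_level[OF t \<nu>] level_point[OF \<nu> t] assms by blast
qed

lemma level_point_in_ring:
  assumes "norm \<nu> = 1" "0 < t" "t < 1"
  shows "level_point \<nu> t \<in> \<Omega>"
proof -
  have "0 \<le> t" "t \<le> 1" using assms by simp_all
  note p = level_point[OF assms(1) this]
  have "level_point \<nu> t \<notin> frontier \<Omega>0" "level_point \<nu> t \<notin> frontier \<Omega>1"
    using frontier_levels[OF p(1)] p(2) assms(2,3) by simp_all
  then show ?thesis using p(1) unfolding closure_ring by blast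
qed

text \<open>A continuous bijection of the compact set \<open>closure \<Omega>\<close> has a continuous inverse.\<close>

lemma level_point_continuous:
  assumes \<nu>: "norm \<nu> = 1"
  shows "continuous_on {0..1} (level_point \<nu>)"
proof -
  define F where "F x = (sgn (Du x), u x)" for x
  have F: "continuous_on (closure \<Omega>) F" unfolding F_def
    by (intro continuous_on_Pair continuous_on_sgn Du_continuous u_continuous)
      (use noncritical in blast)
  have "continuous_on (F ` closure \<Omega>) (\<lambda>(\<nu>, t). level_point \<nu> t)"
    by (rule continuous_on_inv[OF F compact_closure_ring])
      (simp add: F_def level_point_unique[symmetric])
  moreover have "(\<nu>, t) \<in> F ` closure \<Omega>" if "t \<in> {0..1}" for t
  proof -
    have "0 \<le> t" "t \<le> 1" using that by simp_all
    note p = level_point[OF \<nu> this]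
    have "F (level_point \<nu> t) = (\<nu>, t)" using p by (simp add: F_def)
    then show ?thesis using p(1) by (metis imageI)
  qed
  then have "(\<lambda>t. (\<nu>, t)) ` {0..1} \<subseteq> F ` closure \<Omega>" by blast
  moreover have "continuous_on {0..1} (\<lambda>t::real. (\<nu>, t))" by (intro continuous_intros)
  ultimately have "continuous_on {0..1} (\<lambda>t. (\<lambda>(\<nu>, t). level_point \<nu> t) (\<nu>, t))"
    using continuous_on_compose2 by blast
  then show ?thesis by simp
qed

definition gradient_length :: "real^'n \<Rightarrow> real \<Rightarrow> real" where
  "gradient_length \<nu> t = norm (Du (level_point \<nu> t))"

lemma Du_level_point:
  assumes "norm \<nu> = 1" "0 \<le> t" "t \<le> 1"
  shows "Du (level_point \<nu> t) = gradient_length \<nu> t *\<^sub>R \<nu>" and "0 < gradient_length \<nu> t"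
proof -
  have nz: "Du (level_point \<nu> t) \<noteq> 0" by (rule noncritical[OF level_point(1)[OF assms]])
  then show "0 < gradient_length \<nu> t" by (simp add: gradient_length_def)
  have "Du (level_point \<nu> t) = norm (Du (level_point \<nu> t)) *\<^sub>R sgn (Du (level_point \<nu> t))"
    using nz by (simp add: sgn_div_norm)
  then show "Du (level_point \<nu> t) = gradient_length \<nu> t *\<^sub>R \<nu>"
    unfolding level_point(3)[OF assms] gradient_length_def .
qed

lemma gradient_length_continuous:
  assumes \<nu>: "norm \<nu> = 1"
  shows "continuous_on {0..1} (gradient_length \<nu>)"
proof -
  have "level_point \<nu> ` {0..1} \<subseteq> closure \<Omega>"
    using level_point(1)[OF \<nu>] by auto
  from continuous_on_compose2[OF Du_continuous level_point_continuous[OF \<nu>] this]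
  show ?thesis unfolding gradient_length_def[abs_def] by (intro continuous_intros)
qed

text \<open>Global injectivity of \<open>Du\<close> rests on the monotonicity of \<open>|Du|\<close> along the curves of constant
  direction. A local inverse is enough to differentiate along them.\<close>

lemma gradient_local_inverse:
  assumes x: "x \<in> \<Omega>"
  obtains V G where "open V" "x \<in> V" "\<And>y. y \<in> V \<Longrightarrow> G (gradient u y) = y"
    "\<And>z. hessian u x *v z = q \<Longrightarrow> \<exists>G'. (G has_derivative G') (at (gradient u x)) \<and> G' q = z"
proof -
  define H where "H y = Blinfun (\<lambda>h. hessian u y *v h)" for y
  have H: "blinfun_apply (H y) = (\<lambda>h. hessian u y *v h)" for y
    unfolding H_def by (rule bounded_linear_Blinfun_apply) simp
  have der: "(gradient u has_derivative blinfun_apply (H y)) (at y)" if "y \<in> \<Omega>" for y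
    unfolding H by (rule hessian_has_derivative[OF open_ring that u_C2])
  have cont: "continuous_on \<Omega> H"
  proof (rule continuous_on_blinfun_componentwise)
    fix i :: "real^'n" assume i: "i \<in> Basis"
    have "Ck_on 0 (\<lambda>y. frechet_derivative (gradient u) (at y) i) \<Omega>"
      by (rule Ck_on_derivative[OF Ck_on_gradient[OF open_ring u_C2] i])
    moreover have "frechet_derivative (gradient u) (at y) i = H y i" if "y \<in> \<Omega>" for y
      using frechet_derivative_at[OF der[OF that]] by simp
    ultimately show "continuous_on \<Omega> (\<lambda>y. H y i)" by (simp cong: continuous_on_cong)
  qed
  have det: "det (hessian u x) \<noteq> 0" by (rule lorentzian_det_nonzero[OF hessian_lorentzian[OF x]])
  then obtain B where B: "B ** hessian u x = mat 1"
    using invertible_det_nz invertible_left_inverse by blast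
  define invH where "invH = Blinfun (\<lambda>h. B *v h)"
  have invH: "blinfun_apply invH = (\<lambda>h. B *v h)"
    unfolding invH_def by (rule bounded_linear_Blinfun_apply) simp
  have "invH o\<^sub>L H x = id_blinfun"
    by (rule blinfun_eqI) (simp add: invH H matrix_vector_mul_assoc B)
  from inverse_function_theorem[OF open_ring der cont x this]
  obtain V W G G' where V: "open V" "V \<subseteq> \<Omega>" "x \<in> V" "open W" "gradient u x \<in> W"
    and hom: "homeomorphism V W (gradient u) G"
    and G: "\<And>y. y \<in> W \<Longrightarrow> (G has_derivative (G' y)) (at y)"
    and G': "\<And>y. y \<in> W \<Longrightarrow> G' y = inv (blinfun_apply (H (G y)))"
    and bij: "\<And>y. y \<in> W \<Longrightarrow> bij (blinfun_apply (H (G y)))" by metis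
  have Gx: "G (gradient u x) = x" using hom V(3) by (simp add: homeomorphism_def)
  have "\<exists>G'. (G has_derivative G') (at (gradient u x)) \<and> G' q = z" if "hessian u x *v z = q" for z
  proof -
    have "inv (blinfun_apply (H x)) q = z"
      using bij[OF V(5)] that unfolding Gx by (intro inv_f_eq) (simp_all add: bij_is_inj H)
    then show ?thesis using G[OF V(5)] G'[OF V(5)] unfolding Gx by metis
  qed
  then show thesis using V hom by (intro that[of V G]) (auto simp: homeomorphism_def)
qed

text \<open>With the local inverse \<open>G\<close> of \<open>Du\<close>, the map \<open>h r = u (G (r \<nu>))\<close> gives the level at which
  the length of \<open>Du\<close> is \<open>r\<close>. Its derivative is \<open>Du \<bullet> A\<inverse> \<nu>\<close>, where \<open>A\<close> is the Hessian, and this is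
  positive. The length as a function of the level is the inverse of \<open>h\<close>.\<close>

lemma gradient_length_derivative_positive:
  assumes \<nu>: "norm \<nu> = 1" and t: "0 < t" "t < 1"
  shows "\<exists>d>0. (gradient_length \<nu> has_real_derivative d) (at t)"
proof -
  define x where "x = level_point \<nu> t"
  have x: "x \<in> \<Omega>" unfolding x_def by (rule level_point_in_ring[OF \<nu> t])
  define \<rho> where "\<rho> = gradient_length \<nu> t"
  have t': "0 \<le> t" "t \<le> 1" using t by simp_all
  have \<rho>: "0 < \<rho>" and grad: "gradient u x = \<rho> *\<^sub>R \<nu>"
    using Du_level_point[OF \<nu> t'] Du_interior[OF x] by (simp_all add: \<rho>_def x_def)
  have "det (hessian u x) \<noteq> 0" by (rule lorentzian_det_nonzero[OF hessian_lorentzian[OF x]])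
  then obtain B where "hessian u x ** B = mat 1"
    using invertible_det_nz invertible_right_inverse by blast
  then have z: "hessian u x *v (B *v gradient u x) = gradient u x"
    by (simp add: matrix_vector_mul_assoc)
  define z where "z = B *v gradient u x"
  note z = z[folded z_def]
  have pos: "0 < z \<bullet> gradient u x"
    by (rule lorentzian_preimage_of_normal[OF hessian_lorentzian[OF x] gradient_nonzero[OF x] z])
  have hz: "hessian u x *v ((1 / \<rho>) *\<^sub>R z) = \<nu>"
    using \<rho> by (simp add: matrix_vector_mult_scaleR z grad)
  obtain V G where V: "open V" "x \<in> V" and GV: "\<And>y. y \<in> V \<Longrightarrow> G (gradient u y) = y"
    and G': "\<And>z. hessian u x *v z = \<nu> \<Longrightarrow> \<exists>G'. (G has_derivative G') (at (gradient u x)) \<and> G' \<nu> = z"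
    by (rule gradient_local_inverse[OF x, of \<nu>]) (rule that)
  obtain G' where der_G: "(G has_derivative G') (at (gradient u x))" and G'\<nu>: "G' \<nu> = (1 / \<rho>) *\<^sub>R z"
    using G'[OF hz] by blast
  define h where "h r = u (G (r *\<^sub>R \<nu>))" for r
  define D where "D = gradient u x \<bullet> ((1 / \<rho>) *\<^sub>R z)"
  have D: "0 < D" using pos \<rho> by (simp add: D_def inner_commute)
  have "((\<lambda>y. u (G y)) has_derivative (\<lambda>k. gradient u x \<bullet> G' k)) (at (0 + \<rho> *\<^sub>R \<nu>))"
  proof -
    have "(u has_derivative (\<lambda>k. gradient u x \<bullet> k)) (at (G (gradient u x)))"
      using u_derivative[OF x] GV[OF V(2)] by simp
    from has_derivative_compose[OF der_G this] show ?thesis by (simp add: grad)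
  qed
  from line_derivative[OF this]
  have der_h: "(h has_real_derivative D) (at (gradient_length \<nu> t))"
    by (simp add: h_def[abs_def] D_def G'\<nu> \<rho>_def)
  have cont: "continuous_on {0<..<1} (level_point \<nu>)"
    by (rule continuous_on_subset[OF level_point_continuous[OF \<nu>]]) auto
  have tI: "t \<in> {0<..<1}" using t by simp
  have "\<forall>\<^sub>F s in nhds t. level_point \<nu> s \<in> V \<and> s \<in> {0<..<1}"
  proof (intro eventually_conj)
    have "isCont (level_point \<nu>) t"
      using cont tI by (simp add: continuous_on_eq_continuous_at)
    then have "(level_point \<nu> \<longlongrightarrow> level_point \<nu> t) (nhds t)"
      by (simp only: isCont_def tendsto_at_iff_tendsto_nhds)
    then show "\<forall>\<^sub>F s in nhds t. level_point \<nu> s \<in> V"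
      by (rule topological_tendstoD) (use V in \<open>simp_all add: x_def\<close>)
    show "\<forall>\<^sub>F s in nhds t. s \<in> {0<..<1}" using tI by (intro eventually_nhds_in_open) simp_all
  qed
  then obtain e where e: "0 < e" "\<And>s. dist s t < e \<Longrightarrow> level_point \<nu> s \<in> V \<and> s \<in> {0<..<1}"
    unfolding eventually_nhds_metric by blast
  have "h (gradient_length \<nu> s) = s" if "t - e < s" "s < t + e" for s
  proof -
    have s: "level_point \<nu> s \<in> V" "0 < s" "s < 1"
      using e(2)[of s] that by (auto simp: dist_real_def abs_less_iff)
    have s': "0 \<le> s" "s \<le> 1" using s by simp_all
    have "gradient u (level_point \<nu> s) = gradient_length \<nu> s *\<^sub>R \<nu>"
      using Du_level_point(1)[OF \<nu> s'] Du_interior[OF level_point_in_ring[OF \<nu> s(2,3)]] by simp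
    then have "G (gradient_length \<nu> s *\<^sub>R \<nu>) = level_point \<nu> s" using GV[OF s(1)] by simp
    then show ?thesis using level_point(2)[OF \<nu> s'] by (simp add: h_def)
  qed
  moreover have "isCont (gradient_length \<nu>) t"
  proof -
    have "continuous_on {0<..<1} (gradient_length \<nu>)"
      by (rule continuous_on_subset[OF gradient_length_continuous[OF \<nu>]]) auto
    then show ?thesis using tI by (simp add: continuous_on_eq_continuous_at)
  qed
  ultimately have "(gradient_length \<nu> has_real_derivative inverse D) (at t)"
    using e(1) D
    by (intro DERIV_inverse_function[where f = h and g = "gradient_length \<nu>" and a = "t - e" and b = "t + e"] der_h)
      simp_all
  then show ?thesis using D by (intro exI[of _ "inverse D"]) simp
qed

lemma gradient_length_strictly_increasing:
  assumes \<nu>: "norm \<nu> = 1" and st: "0 \<le> s" "s < t" "t \<le> 1"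
  shows "gradient_length \<nu> s < gradient_length \<nu> t"
proof (rule DERIV_pos_imp_increasing_open[OF st(2)])
  show "\<exists>d. (gradient_length \<nu> has_real_derivative d) (at r) \<and> 0 < d" if "s < r" "r < t" for r
    using gradient_length_derivative_positive[OF \<nu>, of r] that st by auto
  show "continuous_on {s..t} (gradient_length \<nu>)"
    by (rule continuous_on_subset[OF gradient_length_continuous[OF \<nu>]]) (use st in auto)
qed

text \<open>Equal gradients have the same direction, so both points lie on the same curve, and the
  same length, so they lie at the same level.\<close>

lemma gradient_injective: "inj_on (gradient u) \<Omega>"
proof (rule inj_onI)
  fix x y assume x: "x \<in> \<Omega>" and y: "y \<in> \<Omega>" and eq: "gradient u x = gradient u y"
  define \<nu> where "\<nu> = sgn (gradient u x)"
  have \<nu>: "norm \<nu> = 1" using gradient_nonzero[OF x] by (simp add: \<nu>_def norm_sgn)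
  have lp: "w = level_point \<nu> (u w)" "norm (gradient u w) = gradient_length \<nu> (u w)"
    if "w \<in> \<Omega>" "gradient u w = gradient u x" for w
  proof -
    have "w \<in> closure \<Omega>" using that(1) closure_subset by blast
    from level_point_unique[OF this] show w: "w = level_point \<nu> (u w)"
      using Du_interior[OF that(1)] that(2) by (simp add: \<nu>_def)
    show "norm (gradient u w) = gradient_length \<nu> (u w)"
      unfolding gradient_length_def w[symmetric] using Du_interior[OF that(1)] by simp
  qed
  have "gradient_length \<nu> (u x) = gradient_length \<nu> (u y)" using lp(2)[OF x] lp(2)[OF y] eq by simp
  then have "u x = u y"
    using gradient_length_strictly_increasing[OF \<nu>, of "u x" "u y"] gradient_length_strictly_increasing[OF \<nu>, of "u y" "u x"]
      u_bounds[OF x] u_bounds[OF y] by (cases "u x" "u y" rule: linorder_cases) auto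
  then show "x = y" using lp(1)[OF x refl] lp(1)[OF y] eq by metis
qed

abbreviation gradient_ring :: "(real^'n) set" where
  "gradient_ring \<equiv> radial_ring (\<lambda>\<nu>. norm (Du (level_point \<nu> 0))) (\<lambda>\<nu>. norm (Du (level_point \<nu> 1)))"

lemma gradient_image: "gradient u ` \<Omega> = gradient_ring"
proof
  show "gradient u ` \<Omega> \<subseteq> gradient_ring"
  proof
    fix q assume "q \<in> gradient u ` \<Omega>"
    then obtain x where x: "x \<in> \<Omega>" "q = gradient u x" by blast
    define \<nu> where "\<nu> = sgn (Du x)"
    have xc: "x \<in> closure \<Omega>" using x closure_subset by blast
    have \<nu>: "norm \<nu> = 1" using noncritical[OF xc] by (simp add: \<nu>_def norm_sgn)
    have u: "0 < u x" "u x < 1" using u_bounds[OF x(1)] by simp_all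
    have xp: "x = level_point \<nu> (u x)" unfolding \<nu>_def by (rule level_point_unique[OF xc])
    have "q = gradient_length \<nu> (u x) *\<^sub>R \<nu>"
      using Du_level_point(1)[OF \<nu>, of "u x"] xp u Du_interior[OF x(1)] x(2) by simp
    moreover have "gradient_length \<nu> 0 < gradient_length \<nu> (u x)" "gradient_length \<nu> (u x) < gradient_length \<nu> 1"
      using gradient_length_strictly_increasing[OF \<nu>] u by simp_all
    ultimately show "q \<in> gradient_ring"
      using \<nu> unfolding radial_ring_def gradient_length_def by blast
  qed
  show "gradient_ring \<subseteq> gradient u ` \<Omega>"
  proof
    fix q assume "q \<in> gradient_ring"
    then obtain r \<nu> where q: "q = r *\<^sub>R \<nu>" and \<nu>: "norm \<nu> = 1" and r: "gradient_length \<nu> 0 < r" "r < gradient_length \<nu> 1"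
      unfolding radial_ring_def gradient_length_def by blast
    obtain t where t: "0 \<le> t" "t \<le> 1" "gradient_length \<nu> t = r"
      using IVT'[of "gradient_length \<nu>" 0 r 1] r gradient_length_continuous[OF \<nu>] by auto
    then have "t \<noteq> 0" "t \<noteq> 1" using r by auto
    then have t': "0 < t" "t < 1" using t by simp_all
    have x: "level_point \<nu> t \<in> \<Omega>" by (rule level_point_in_ring[OF \<nu> t'])
    have "gradient u (level_point \<nu> t) = q"
      using Du_level_point(1)[OF \<nu> t(1,2)] Du_interior[OF x] t(3) q by simp
    then show "q \<in> gradient u ` \<Omega>" using x by blast
  qed
qed

lemma gradient_ring_parametrized: "radially_parametrized_ring \<Omega>0 \<Omega>1 Du gradient_ring"
  unfolding radially_parametrized_ring_def
proof (intro exI conjI allI impI)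
  fix \<nu> :: "real^'n" assume \<nu>: "norm \<nu> = 1"
  have fc: "frontier \<Omega>0 \<subseteq> closure \<Omega>" "frontier \<Omega>1 \<subseteq> closure \<Omega>"
    unfolding closure_ring by blast+
  have lp: "x \<in> closure \<Omega> \<and> u x = t \<and> sgn (Du x) = \<nu> \<longleftrightarrow> x = level_point \<nu> t"
    if "0 \<le> t" "t \<le> 1" for t x
    using level_point[OF \<nu> that] level_point_unique[of x] by auto
  show "x \<in> frontier \<Omega>0 \<and> sgn (Du x) = \<nu> \<longleftrightarrow> x = level_point \<nu> 0" for x
    using lp[of 0 x] frontier_levels(1)[of x] fc(1) by auto
  show "x \<in> frontier \<Omega>1 \<and> sgn (Du x) = \<nu> \<longleftrightarrow> x = level_point \<nu> 1" for x
    using lp[of 1 x] frontier_levels(2)[of x] fc(2) by auto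
  show "0 < norm (Du (level_point \<nu> 0))"
    using Du_level_point(2)[OF \<nu>, of 0] by (simp add: gradient_length_def)
  show "norm (Du (level_point \<nu> 0)) < norm (Du (level_point \<nu> 1))"
    using gradient_length_strictly_increasing[OF \<nu>, of 0 1] by (simp add: gradient_length_def)
qed (rule refl)

lemma gradient_diffeomorphism: "Ck_diffeomorphism (Suc (Suc 0)) (gradient u) \<Omega> gradient_ring"
proof -
  have C2: "Ck_on (Suc (Suc 0)) (gradient u) \<Omega>" by (rule Ck_on_gradient[OF open_ring u_C3])
  have "Ck_on 0 (gradient u) \<Omega>" by (rule Ck_on_le[OF C2]) simp
  then have cont: "continuous_on \<Omega> (gradient u)" by simp
  have opn: "open gradient_ring"
    unfolding gradient_image[symmetric] by (rule invariance_of_domain[OF cont open_ring gradient_injective])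
  obtain g where g: "homeomorphism \<Omega> gradient_ring (gradient u) g"
    using invariance_of_domain_homeomorphism[OF open_ring cont _ gradient_injective]
    unfolding gradient_image by blast
  have "Ck_on (Suc (Suc 0)) g gradient_ring"
  proof (rule Ck_on_inverse_map[OF open_ring opn g C2])
    fix x assume x: "x \<in> \<Omega>"
    have "frechet_derivative (gradient u) (at x) = (\<lambda>h. hessian u x *v h)"
      using frechet_derivative_at[OF hessian_has_derivative[OF open_ring x u_C2]] by simp
    then show "det (matrix (frechet_derivative (gradient u) (at x))) \<noteq> 0"
      using lorentzian_det_nonzero[OF hessian_lorentzian[OF x]] by (simp add: matrix_of_matrix_vector_mul)
  qed
  then show ?thesis unfolding Ck_diffeomorphism_def using open_ring opn C2 g by blast
qed

end

theorem theorem1p4: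
  fixes \<Omega>0 \<Omega>1 \<Omega> \<U> :: "(real^'n::finite) set"
    and a :: "real^'n \<Rightarrow> real^'n^'n"
    and u :: "real^'n \<Rightarrow> real"
  assumes "CARD('n) \<ge> 2"
    and "smooth_strictly_convex_domain \<Omega>0"
    and "smooth_strictly_convex_domain \<Omega>1"
    and "closure \<Omega>1 \<subseteq> \<Omega>0"
    and "\<Omega> = \<Omega>0 - closure \<Omega>1"
    and "open \<U>"
    and "continuous_on \<U> a"
    and "\<forall>q\<in>\<U>. transpose (a q) = a q"
    and "\<forall>q\<in>\<U>. positive_definite (a q)"
    and "Ck_on 3 u \<Omega>"
    and "Ck_on_closure 2 u \<Omega>"
    and "gradient_closure \<Omega> u ` closure \<Omega> \<subseteq> \<U>"
    and "\<forall>x\<in>\<Omega>. (\<Sum>i\<in>UNIV. \<Sum>j\<in>UNIV. a (gradient u x) $ i $ j * hessian u x $ i $ j) = 0"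
    and "\<forall>x\<in>frontier \<Omega>0. u x = 0"
    and "\<forall>x\<in>frontier \<Omega>1. u x = 1"
    and "\<forall>x\<in>closure \<Omega>. norm (gradient_closure \<Omega> u x) > 0"
    and "\<forall>t\<in>{0..1}. smooth_strictly_convex_boundary (superlevel_body \<Omega> \<Omega>1 u t)"
  shows "(\<forall>x\<in>\<Omega>. (-1) ^ (CARD('n) - 1) * det (hessian u x) > 0) \<and>
    (\<exists>R. radially_parametrized_ring \<Omega>0 \<Omega>1 (gradient_closure \<Omega> u) R \<and>
         Ck_diffeomorphism 2 (gradient u) \<Omega> R)"
proof -
  have three: "(3::nat) = Suc (Suc (Suc 0))" and two: "(2::nat) = Suc (Suc 0)" by simp_all
  interpret convex_ring_solution \<Omega>0 \<Omega>1 \<Omega> \<U> a u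
  proof
    show "Ck_on (Suc (Suc (Suc 0))) u \<Omega>" using assms(10) unfolding three .
    show "Ck_on_closure (Suc (Suc 0)) u \<Omega>" using assms(11) unfolding two .
  qed (use assms in \<open>auto\<close>)
  show ?thesis
    unfolding two using hessian_det_sign gradient_ring_parametrized gradient_diffeomorphism by blast
qed

end
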